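(* Let $S=[0,1]$ with the usual metric $d(x,y)=|x-y|$. There are no $\pi_{2,2}$-invariant distributions on $[0,1]$ other than those of the form $\delta_s$ (with $s\in[0,1]$) or $\delta_{s_1,s_2}=\frac12(\delta_{s_1}+\delta_{s_2})$ (with $s_1,s_2\in[0,1]$ distinct).
   Context: $\mathcal P(S)$ is the set of Borel probability measures on a compact metric space $(S,d)$. Given $\theta\in\mathcal P(S)$ and integers $k\ge 2$, $1\le j\le k$, consider the Markov chain on $S$ which from state $s$ draws $k$ i.i.d. samples from $\theta$ and jumps to the $j$'th nearest of them to $s$ (ordering by increasing distance from $s$, ties broken uniformly at random). This chain has a unique stationary distribution, denoted $\pi_{j,k}(\theta)$, which defines a map $\pi_{j,k}:\mathcal P(S)\to\mathcal P(S)$. A distribution $\phi$ is $\pi_{j,k}$-invariant if $\pi_{j,k}(\phi)=\phi$. (In particular, for $\pi_{2,2}$ the chain jumps to the farther of two i.i.d. samples.) $\delta_s$ denotes the point mass at $s$. *)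

theory Defs
  imports "HOL-Probability.Probability"
begin

definition borel_probs :: "'a::metric_space set \<Rightarrow> 'a measure set" where
  "borel_probs S = space (prob_algebra (restrict_space borel S))"

text \<open>
  A family of samples \<^term>\<open>x\<close> is indexed by \<^term>\<open>{..<k}\<close>. When the samples are ordered by increasing
  distance from \<^term>\<open>s\<close>, the index \<^term>\<open>i\<close> can occupy position \<^term>\<open>j\<close> (counted from 1) iff fewer than
  \<^term>\<open>j\<close> samples are strictly nearer and at least \<^term>\<open>j\<close> samples are as near. This set has more than
  one element exactly when there is a tie at position \<^term>\<open>j\<close>. Indices rather than points are
  collected, so that coinciding samples are counted with multiplicity in a tie.
\<close>

definition jth_nearest :: "nat \<Rightarrow> nat \<Rightarrow> 'a::metric_space \<Rightarrow> (nat \<Rightarrow> 'a) \<Rightarrow> nat set" where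
  "jth_nearest j k s x =
     {i \<in> {..<k}. card {l \<in> {..<k}. dist s (x l) < dist s (x i)} < j \<and>
                  j \<le> card {l \<in> {..<k}. dist s (x l) \<le> dist s (x i)}}"

definition jump :: "nat \<Rightarrow> nat \<Rightarrow> 'a::metric_space measure \<Rightarrow> 'a \<Rightarrow> 'a measure" where
  "jump j k \<theta> s =
     (\<Pi>\<^sub>M i\<in>{..<k}. \<theta>) \<bind> (\<lambda>x. distr (uniform_count_measure (jth_nearest j k s x)) \<theta> x)"

definition stationary :: "nat \<Rightarrow> nat \<Rightarrow> 'a::metric_space measure \<Rightarrow> 'a measure \<Rightarrow> bool" where
  "stationary j k \<theta> \<mu> \<longleftrightarrow> \<mu> \<in> space (prob_algebra \<theta>) \<and> \<mu> \<bind> jump j k \<theta> = \<mu>"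

text \<open>
  For \<^prop>\<open>1 \<le> j\<close>, \<^prop>\<open>j \<le> k\<close> and a Borel probability measure \<^term>\<open>\<theta>\<close> on a compact set,
  the stationary distribution exists and is unique.
\<close>

definition pi_map :: "nat \<Rightarrow> nat \<Rightarrow> 'a::metric_space measure \<Rightarrow> 'a measure" where
  "pi_map j k \<theta> = (THE \<mu>. stationary j k \<theta> \<mu>)"

definition pi_invariant :: "'a::metric_space set \<Rightarrow> nat \<Rightarrow> nat \<Rightarrow> 'a measure \<Rightarrow> bool" where
  "pi_invariant S j k \<phi> \<longleftrightarrow> \<phi> \<in> borel_probs S \<and> pi_map j k \<phi> = \<phi>"

definition point_mass :: "'a::metric_space set \<Rightarrow> 'a \<Rightarrow> 'a measure" where
  "point_mass S s = return (restrict_space borel S) s"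

definition two_point_mass :: "'a::metric_space set \<Rightarrow> 'a \<Rightarrow> 'a \<Rightarrow> 'a measure" where
  "two_point_mass S s1 s2 =
     measure_of S (sets (restrict_space borel S))
       (\<lambda>A. 1 / 2 * (emeasure (point_mass S s1) A + emeasure (point_mass S s2) A))"

end

theory Submission
  imports Defs
begin

text \<open>
  Write \<open>\<theta>\<close> for the distribution of the samples. From a state \<open>s\<close> the chain jumps according to the
  density \<open>k s x = \<theta> {y. d s y < d s x} + \<theta> {y. d s y \<le> d s x}\<close> with respect to \<open>\<theta>\<close>: the
  competing sample has to be nearer to \<open>s\<close>, and a tie counts half.

  The map \<^const>\<open>pi_map\<close> is defined by a definite description, so invariance says something about
  \<open>\<theta>\<close> only because the stationary distribution exists and is unique. This is Doeblin's argument.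
  For each \<open>s\<close> the density \<open>k s\<close> is at least 1/8 outside a set of mass at most 1/4, because only few
  points can have little mass within their own distance from \<open>s\<close> (\<open>measure_square_le_rank\<close>, \<open>jump_density_spread\<close>). Two
  successive jumps therefore dominate a fixed function of positive mass (\<open>minorant_le\<close>, \<open>minorant_mass_pos\<close>),
  and the remaining part of the two-step kernel loses mass. The invariant density is the resulting
  Neumann series, whose terms are nonnegative (\<open>series_least\<close>, \<open>series_integral\<close>); this gives existence
  and uniqueness at once (\<open>stationary_unique\<close>).

  So an invariant \<open>\<theta>\<close> is stationary for its own chain, which means that the density of a jump from a
  source with law \<open>\<theta>\<close> is 1 at almost every target \<open>x\<close>. On the line this is very restrictive. Let \<open>a\<close>
  and \<open>b\<close> be the endpoints of the support, \<open>a < b\<close>, and \<open>m\<close> their midpoint. From a source to the right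
  of \<open>m\<close> the point \<open>a\<close> is the farthest one, and from a source to the left of \<open>m\<close> it still beats the
  points between itself and the source. Evaluating the balance at \<open>a\<close>
  (\<open>endpoint_inequality\<close>) shows, if \<open>m\<close> carries no mass, that the right half has no more mass than the
  left half, and strictly less if there is mass strictly between \<open>a\<close> and \<open>m\<close>. The reflected inequality
  is the opposite one. Mass at \<open>m\<close> would make the two contradictory. Hence both halves have mass 1/2,
  and all of it sits at \<open>a\<close> and \<open>b\<close> (\<open>endpoint_masses_half\<close>). If the endpoints are not atoms, the balance is used at nearby points
  (\<open>nearer_integral_le\<close>).
\<close>

section \<open>Ranks within a set\<close>

lemma emeasure_Collect_eq_nn_integral:
  assumes "{x\<in>space M. P x} \<in> sets M"
  shows "emeasure M {x\<in>space M. P x} = (\<integral>\<^sup>+x. of_bool (P x) \<partial>M)"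
proof -
  have "emeasure M {x\<in>space M. P x} = (\<integral>\<^sup>+x. indicator {x\<in>space M. P x} x \<partial>M)"
    using assms by simp
  also have "\<dots> = (\<integral>\<^sup>+x. of_bool (P x) \<partial>M)"
    by (intro nn_integral_cong) (simp add: indicator_def)
  finally show ?thesis .
qed

text \<open>
  Of two independent points that fall in \<^term>\<open>B\<close>, at least one has rank not above the other, so by
  exchangeability each of the two orders has probability at least half of that of falling in \<^term>\<open>B\<close>
  twice. The bound serves twice: it shows that few targets have a small jump density, and it shows that
  no mass lies strictly between an endpoint of the support and the midpoint.
\<close>

lemma (in prob_space) measure_square_le_rank:
  fixes R :: "'a \<Rightarrow> real"
  assumes [measurable]: "R \<in> borel_measurable M" "B \<in> sets M"
  shows "emeasure M B * emeasure M B \<le> 2 * (\<integral>\<^sup>+s\<in>B. emeasure M {y\<in>B. R y \<le> R s} \<partial>M)"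
proof -
  let ?I = "\<lambda>s y. indicator B s * indicator B y * of_bool (R y \<le> R s) :: ennreal"
  interpret P: pair_sigma_finite M M ..
  have eq: "(\<integral>\<^sup>+s\<in>B. emeasure M {y\<in>B. R y \<le> R s} \<partial>M) = (\<integral>\<^sup>+s. \<integral>\<^sup>+y. ?I s y \<partial>M \<partial>M)"
  proof (rule nn_integral_cong)
    fix s assume "s \<in> space M"
    have "{y\<in>B. R y \<le> R s} = {y\<in>space M. y \<in> B \<and> R y \<le> R s}"
      using sets.sets_into_space[OF assms(2)] by auto
    also have "\<dots> \<in> sets M" by measurable
    finally have m: "{y\<in>B. R y \<le> R s} \<in> sets M" .
    have "emeasure M {y\<in>B. R y \<le> R s} * indicator B s = (\<integral>\<^sup>+y. indicator {y\<in>B. R y \<le> R s} y * indicator B s \<partial>M)"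
      using m by (simp add: nn_integral_multc)
    also have "\<dots> = (\<integral>\<^sup>+y. ?I s y \<partial>M)"
      by (intro nn_integral_cong) (auto simp: indicator_def)
    finally show "emeasure M {y\<in>B. R y \<le> R s} * indicator B s = (\<integral>\<^sup>+y. ?I s y \<partial>M)" .
  qed
  have "emeasure M B * emeasure M B = (\<integral>\<^sup>+s. \<integral>\<^sup>+y. indicator B s * indicator B y \<partial>M \<partial>M)"
    by (simp add: nn_integral_cmult nn_integral_multc)
  also have "\<dots> \<le> (\<integral>\<^sup>+s. \<integral>\<^sup>+y. ?I s y + ?I y s \<partial>M \<partial>M)"
    by (intro nn_integral_mono) (auto simp: indicator_def)
  also have "\<dots> = (\<integral>\<^sup>+s. \<integral>\<^sup>+y. ?I s y \<partial>M \<partial>M) + (\<integral>\<^sup>+s. \<integral>\<^sup>+y. ?I y s \<partial>M \<partial>M)"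
    by (simp add: nn_integral_add)
  also have "(\<integral>\<^sup>+s. \<integral>\<^sup>+y. ?I y s \<partial>M \<partial>M) = (\<integral>\<^sup>+y. \<integral>\<^sup>+s. ?I y s \<partial>M \<partial>M)"
    by (rule P.Fubini') measurable
  finally show ?thesis by (simp add: eq mult_2)
qed

section \<open>Chains whose transition density is rarely small\<close>

text \<open>
  The assumption is uniform in the source \<^term>\<open>s\<close> but the exceptional set may depend on it, so
  the functions \<^term>\<open>k s\<close> need not have a common lower bound other than 0: for the chain below without
  atoms, \<^term>\<open>k s s\<close> vanishes for every \<^term>\<open>s\<close>. Two steps suffice for a Doeblin condition.
\<close>

locale spread_kernel = prob_space M for M :: "'a measure" +
  fixes k :: "'a \<Rightarrow> 'a \<Rightarrow> ennreal" and \<delta> :: ennreal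
  assumes k_meas[measurable]: "case_prod k \<in> borel_measurable (M \<Otimes>\<^sub>M M)"
    and k_prob: "\<And>s. s \<in> space M \<Longrightarrow> (\<integral>\<^sup>+x. k s x \<partial>M) = 1"
    and delta_pos: "0 < \<delta>"
    and spread: "\<And>s. s \<in> space M \<Longrightarrow> emeasure M {x\<in>space M. k s x < \<delta>} \<le> ennreal (1/4)"
begin

sublocale pair: pair_sigma_finite M M ..

definition step :: "('a \<Rightarrow> ennreal) \<Rightarrow> 'a \<Rightarrow> ennreal" where
  "step f x = (\<integral>\<^sup>+s. k s x * f s \<partial>M)"

lemma step_measurable[measurable]:
  assumes [measurable]: "f \<in> borel_measurable M"
  shows "step f \<in> borel_measurable M"
  unfolding step_def[abs_def] by measurable

lemma step_integral:
  assumes [measurable]: "f \<in> borel_measurable M"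
  shows "(\<integral>\<^sup>+x. step f x \<partial>M) = (\<integral>\<^sup>+x. f x \<partial>M)"
proof -
  have "(\<integral>\<^sup>+x. step f x \<partial>M) = (\<integral>\<^sup>+s. \<integral>\<^sup>+x. k s x * f s \<partial>M \<partial>M)"
    unfolding step_def by (rule pair.Fubini') measurable
  also have "\<dots> = (\<integral>\<^sup>+s. f s \<partial>M)"
    by (intro nn_integral_cong) (simp add: nn_integral_multc k_prob)
  finally show ?thesis .
qed

definition two_step :: "'a \<Rightarrow> 'a \<Rightarrow> ennreal" where
  "two_step s x = (\<integral>\<^sup>+y. k s y * k y x \<partial>M)"

lemma two_step_measurable[measurable]: "case_prod two_step \<in> borel_measurable (M \<Otimes>\<^sub>M M)"
  unfolding two_step_def[abs_def] by measurable

lemma two_step_prob: assumes "s \<in> space M" shows "(\<integral>\<^sup>+x. two_step s x \<partial>M) = 1"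
proof -
  have [measurable]: "k s \<in> borel_measurable M" using assms by measurable
  have "(\<integral>\<^sup>+x. two_step s x \<partial>M) = (\<integral>\<^sup>+y. \<integral>\<^sup>+x. k s y * k y x \<partial>M \<partial>M)"
    unfolding two_step_def by (rule pair.Fubini') measurable
  also have "\<dots> = (\<integral>\<^sup>+y. k s y \<partial>M)"
    by (intro nn_integral_cong) (simp add: nn_integral_cmult k_prob)
  finally show ?thesis using assms by (simp add: k_prob)
qed

lemma step_step:
  assumes [measurable]: "f \<in> borel_measurable M" and [measurable]: "x \<in> space M"
  shows "step (step f) x = (\<integral>\<^sup>+s. two_step s x * f s \<partial>M)"
proof -
  have "step (step f) x = (\<integral>\<^sup>+y. \<integral>\<^sup>+s. k y x * (k s y * f s) \<partial>M \<partial>M)"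
    unfolding step_def by (intro nn_integral_cong nn_integral_cmult[symmetric]) measurable
  also have "\<dots> = (\<integral>\<^sup>+s. \<integral>\<^sup>+y. k y x * (k s y * f s) \<partial>M \<partial>M)"
    by (rule pair.Fubini') measurable
  also have "\<dots> = (\<integral>\<^sup>+s. \<integral>\<^sup>+y. (k s y * k y x) * f s \<partial>M \<partial>M)"
    by (simp add: ac_simps)
  also have "\<dots> = (\<integral>\<^sup>+s. two_step s x * f s \<partial>M)"
    unfolding two_step_def by (intro nn_integral_cong nn_integral_multc) measurable
  finally show ?thesis .
qed

text \<open>
  For every source \<^term>\<open>s\<close>, all intermediate points outside a set of mass \<^term>\<open>ennreal (1/4)\<close> are
  reached with density at least \<^term>\<open>\<delta>\<close>. Hence of the intermediate points from which \<^term>\<open>x\<close>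
  has density at least \<^term>\<open>\<delta>\<close>, all but mass \<^term>\<open>ennreal (1/4)\<close> contribute at least
  \<^term>\<open>\<delta> * \<delta>\<close> to the two-step density, whatever \<^term>\<open>s\<close> is. Subtraction on \<^typ>\<open>ennreal\<close>
  truncates at 0.
\<close>

definition minorant :: "'a \<Rightarrow> ennreal" where
  "minorant x = \<delta> * \<delta> * (emeasure M {y\<in>space M. \<delta> \<le> k y x} - ennreal (1/4))"

lemma heavy_sources_measurable[measurable]:
  "(\<lambda>x. emeasure M {y\<in>space M. \<delta> \<le> k y x}) \<in> borel_measurable M"
proof -
  have "(\<lambda>x. \<integral>\<^sup>+y. of_bool (\<delta> \<le> k y x) \<partial>M) \<in> borel_measurable M" by measurable
  then show ?thesis
    by (subst measurable_cong[where g="\<lambda>x. \<integral>\<^sup>+y. of_bool (\<delta> \<le> k y x) \<partial>M"])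
       (simp_all add: emeasure_Collect_eq_nn_integral)
qed

lemma minorant_measurable[measurable]: "minorant \<in> borel_measurable M"
  unfolding minorant_def[abs_def] by measurable

lemma minorant_le:
  assumes [measurable]: "s \<in> space M" "x \<in> space M"
  shows "minorant x \<le> two_step s x"
proof -
  let ?A = "{y\<in>space M. \<delta> \<le> k s y}" and ?B = "{y\<in>space M. \<delta> \<le> k y x}"
  have "emeasure M ?B \<le> emeasure M ((?A \<inter> ?B) \<union> {y\<in>space M. k s y < \<delta>})"
    by (intro emeasure_mono) auto
  also have "\<dots> \<le> emeasure M (?A \<inter> ?B) + emeasure M {y\<in>space M. k s y < \<delta>}"
    by (intro emeasure_subadditive) auto
  also have "\<dots> \<le> emeasure M (?A \<inter> ?B) + ennreal (1/4)"
    using spread[OF assms(1)] by (intro add_left_mono)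
  finally have "emeasure M ?B - ennreal (1/4) \<le> emeasure M (?A \<inter> ?B)"
    by (simp add: ennreal_minus_le_iff add.commute)
  then have "minorant x \<le> \<delta> * \<delta> * emeasure M (?A \<inter> ?B)"
    unfolding minorant_def by (rule mult_left_mono) simp
  also have "\<dots> = (\<integral>\<^sup>+y. \<delta> * \<delta> * indicator (?A \<inter> ?B) y \<partial>M)"
    by (simp add: nn_integral_cmult)
  also have "\<dots> \<le> two_step s x"
    unfolding two_step_def by (intro nn_integral_mono) (auto simp: indicator_def intro!: mult_mono)
  finally show ?thesis .
qed

definition minorant_mass :: ennreal where "minorant_mass = (\<integral>\<^sup>+x. minorant x \<partial>M)"

text \<open>
  Averaged over \<^term>\<open>x\<close>, the mass of intermediate points with density at least \<^term>\<open>\<delta>\<close> at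
  \<^term>\<open>x\<close> is at least 3/4, by exchanging the order of integration. This exceeds the 1/4 that the
  minorant subtracts.
\<close>

lemma minorant_mass_pos: "0 < minorant_mass"
proof -
  let ?p = "\<lambda>x. emeasure M {y\<in>space M. \<delta> \<le> k y x}"
  have big: "ennreal (3/4) \<le> emeasure M {x\<in>space M. \<delta> \<le> k s x}" if [measurable]: "s \<in> space M" for s
  proof -
    have "prob {x\<in>space M. \<delta> \<le> k s x} = 1 - prob {x\<in>space M. k s x < \<delta>}"
      by (subst prob_compl[symmetric]) (auto intro!: arg_cong[where f=prob])
    moreover have "prob {x\<in>space M. k s x < \<delta>} \<le> 1/4"
      using spread[OF that] unfolding emeasure_eq_measure
      by simp
    ultimately have "ennreal (3/4) \<le> emeasure M {x\<in>space M. \<delta> \<le> k s x}"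
      unfolding emeasure_eq_measure by (intro ennreal_leI) simp
    then show ?thesis .
  qed
  have le_minus_add: "a \<le> (a - b) + b" for a b :: ennreal
    using ennreal_minus_le_iff[of a b "a - b"] by (simp add: add.commute)
  have "ennreal (3/4) = (\<integral>\<^sup>+s. ennreal (3/4) \<partial>M)" by (simp add: emeasure_space_1)
  also have "\<dots> \<le> (\<integral>\<^sup>+s. emeasure M {x\<in>space M. \<delta> \<le> k s x} \<partial>M)"
    by (intro nn_integral_mono big)
  also have "\<dots> = (\<integral>\<^sup>+s. \<integral>\<^sup>+x. of_bool (\<delta> \<le> k s x) \<partial>M \<partial>M)"
    by (intro nn_integral_cong) (simp add: emeasure_Collect_eq_nn_integral)
  also have "\<dots> = (\<integral>\<^sup>+x. \<integral>\<^sup>+s. of_bool (\<delta> \<le> k s x) \<partial>M \<partial>M)"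
    by (rule pair.Fubini'[symmetric]) measurable
  also have "\<dots> = (\<integral>\<^sup>+x. ?p x \<partial>M)"
    by (intro nn_integral_cong) (simp add: emeasure_Collect_eq_nn_integral)
  also have "\<dots> \<le> (\<integral>\<^sup>+x. (?p x - ennreal (1/4)) + ennreal (1/4) \<partial>M)"
    by (intro nn_integral_mono le_minus_add)
  also have "\<dots> = (\<integral>\<^sup>+x. (?p x - ennreal (1/4)) \<partial>M) + ennreal (1/4)"
    by (simp add: nn_integral_add emeasure_space_1)
  finally have "(\<integral>\<^sup>+x. (?p x - ennreal (1/4)) \<partial>M) \<noteq> 0"
    using ennreal_le_iff[of "1/4" "3/4"] by (intro notI) simp
  then show ?thesis
    unfolding minorant_mass_def minorant_def using delta_pos by (auto simp: nn_integral_cmult zero_less_iff_neq_zero)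
qed

lemma minorant_mass_le_1: "minorant_mass \<le> 1"
proof -
  obtain s where "s \<in> space M" using not_empty by auto
  then have "minorant_mass \<le> (\<integral>\<^sup>+x. two_step s x \<partial>M)"
    unfolding minorant_mass_def by (intro nn_integral_mono minorant_le)
  then show ?thesis using two_step_prob[OF \<open>s \<in> space M\<close>] by simp
qed

text \<open>
  The two-step operator splits as the rank-one operator that resets to \<^const>\<open>minorant\<close>, plus this
  residual operator, which loses the fraction \<^const>\<open>minorant_mass\<close> of the total mass.
\<close>

definition residual :: "('a \<Rightarrow> ennreal) \<Rightarrow> 'a \<Rightarrow> ennreal" where
  "residual f x = (\<integral>\<^sup>+s. (two_step s x - minorant x) * f s \<partial>M)"

lemma residual_measurable[measurable]:
  assumes [measurable]: "f \<in> borel_measurable M"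
  shows "residual f \<in> borel_measurable M"
  unfolding residual_def[abs_def] by measurable

lemma minorant_split:
  "s \<in> space M \<Longrightarrow> x \<in> space M \<Longrightarrow> (two_step s x - minorant x) + minorant x = two_step s x"
  by (rule diff_add_cancel_ennreal[OF minorant_le])

lemma step_step_eq_residual:
  assumes [measurable]: "f \<in> borel_measurable M" "x \<in> space M"
  shows "step (step f) x = residual f x + minorant x * (\<integral>\<^sup>+s. f s \<partial>M)"
proof -
  have "step (step f) x = (\<integral>\<^sup>+s. (two_step s x - minorant x) * f s + minorant x * f s \<partial>M)"
    by (subst step_step)
       (measurable, auto intro!: nn_integral_cong simp: minorant_split assms simp flip: distrib_right)
  also have "\<dots> = residual f x + (\<integral>\<^sup>+s. minorant x * f s \<partial>M)"
    unfolding residual_def by (rule nn_integral_add) measurable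
  finally show ?thesis by (simp add: nn_integral_cmult)
qed

lemma residual_mono: "(\<And>s. s \<in> space M \<Longrightarrow> f s \<le> g s) \<Longrightarrow> residual f x \<le> residual g x"
  unfolding residual_def by (intro nn_integral_mono mult_left_mono) auto

text \<open>
  A density \<^term>\<open>f\<close> of total mass 1 is invariant under two steps iff
  \<^term>\<open>f = (\<lambda>x. minorant x + residual f x)\<close>. The Neumann series of this affine equation has
  nonnegative terms, so it converges monotonically and its sum is the least solution. Since its mass
  already is 1, every other invariant density agrees with it almost everywhere.
\<close>

primrec partial_sum :: "nat \<Rightarrow> 'a \<Rightarrow> ennreal" where
  "partial_sum 0 = (\<lambda>x. 0)"
| "partial_sum (Suc n) = (\<lambda>x. minorant x + residual (partial_sum n) x)"

lemma partial_sum_measurable[measurable]: "partial_sum n \<in> borel_measurable M"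
  by (induction n) auto

lemma partial_sum_mono: "incseq (\<lambda>n. partial_sum n x)"
proof -
  have "partial_sum n x \<le> partial_sum (Suc n) x" for n x
    by (induction n arbitrary: x) (auto intro!: add_left_mono residual_mono)
  then show ?thesis by (rule incseq_SucI)
qed

definition series where "series x = (SUP n. partial_sum n x)"

lemma series_measurable[measurable]: "series \<in> borel_measurable M"
  unfolding series_def[abs_def] by measurable

lemma series_eq:
  assumes [measurable]: "x \<in> space M"
  shows "series x = minorant x + residual series x"
proof -
  have "residual series x = (\<integral>\<^sup>+s. (SUP n. (two_step s x - minorant x) * partial_sum n s) \<partial>M)"
    unfolding residual_def series_def by (simp add: SUP_mult_left_ennreal)
  also have "\<dots> = (SUP n. residual (partial_sum n) x)"
    unfolding residual_def using partial_sum_mono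
    by (intro nn_integral_monotone_convergence_SUP)
       (auto simp: incseq_def le_fun_def intro!: mult_left_mono)
  finally have "minorant x + residual series x = (SUP n. partial_sum (Suc n) x)"
    by (simp add: ennreal_SUP_add_right)
  also have "\<dots> = series x"
    unfolding series_def
    by (rule antisym)
       (auto simp del: partial_sum.simps intro!: SUP_mono intro: incseq_SucD[OF partial_sum_mono])
  finally show ?thesis ..
qed

lemma series_least:
  assumes [measurable]: "f \<in> borel_measurable M" and "\<And>x. x \<in> space M \<Longrightarrow> f x = step f x"
    and "(\<integral>\<^sup>+x. f x \<partial>M) = 1" and "x \<in> space M"
  shows "series x \<le> f x"
proof -
  have "f x = minorant x + residual f x" if "x \<in> space M" for x
  proof -
    have "f x = step (step f) x"
      using assms(2) that by (simp add: step_def cong: nn_integral_cong)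
    then show ?thesis
      using that by (simp add: step_step_eq_residual assms add.commute)
  qed
  then have "x \<in> space M \<Longrightarrow> partial_sum n x \<le> f x" for n x
    by (induction n arbitrary: x) (auto intro!: add_left_mono residual_mono)
  then show ?thesis
    using assms(4) unfolding series_def by (intro SUP_least)
qed

lemma residual_integral:
  assumes [measurable]: "f \<in> borel_measurable M"
  shows "(\<integral>\<^sup>+x. residual f x \<partial>M) + minorant_mass * (\<integral>\<^sup>+x. f x \<partial>M) = (\<integral>\<^sup>+x. f x \<partial>M)"
proof -
  have "(\<integral>\<^sup>+x. f x \<partial>M) = (\<integral>\<^sup>+x. step (step f) x \<partial>M)"
    by (simp add: step_integral)
  also have "\<dots> = (\<integral>\<^sup>+x. residual f x + minorant x * (\<integral>\<^sup>+s. f s \<partial>M) \<partial>M)"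
    by (intro nn_integral_cong step_step_eq_residual) measurable
  also have "\<dots> = (\<integral>\<^sup>+x. residual f x \<partial>M) + minorant_mass * (\<integral>\<^sup>+x. f x \<partial>M)"
    unfolding minorant_mass_def by (simp add: nn_integral_add nn_integral_multc)
  finally show ?thesis ..
qed

text \<open>
  The residual operator multiplies mass by 1 minus \<^const>\<open>minorant_mass\<close>, so a finite total mass
  that solves the affine equation can only be 1; finiteness follows from the partial sums.
\<close>

lemma series_integral: "(\<integral>\<^sup>+x. series x \<partial>M) = 1"
proof -
  obtain e where e: "minorant_mass = ennreal e" "0 < e" "e \<le> 1"
    using minorant_mass_le_1 minorant_mass_pos by (cases minorant_mass) (auto simp: ennreal_le_iff top_unique)
  have bound: "(\<integral>\<^sup>+x. partial_sum n x \<partial>M) \<le> 1" for n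
  proof (induction n)
    case (Suc n)
    obtain a where a: "(\<integral>\<^sup>+x. partial_sum n x \<partial>M) = ennreal a" "0 \<le> a" "a \<le> 1"
      using Suc by (cases "\<integral>\<^sup>+x. partial_sum n x \<partial>M") (auto simp: top_unique)
    obtain b where b: "(\<integral>\<^sup>+x. residual (partial_sum n) x \<partial>M) = ennreal b" "0 \<le> b"
      using residual_integral[of "partial_sum n"] a
      by (cases "\<integral>\<^sup>+x. residual (partial_sum n) x \<partial>M") auto
    have "b + e * a = a"
      using residual_integral[of "partial_sum n"] a b e by (simp flip: ennreal_mult ennreal_plus)
    moreover have "0 \<le> (1 - e) * (1 - a)" using a e by simp
    ultimately have "e + b \<le> 1" by (simp add: algebra_simps)
    then have "ennreal e + ennreal b \<le> 1" using e b by (simp flip: ennreal_plus)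
    then show ?case by (simp add: nn_integral_add b flip: minorant_mass_def e(1))
  qed simp
  have "(\<integral>\<^sup>+x. series x \<partial>M) = (SUP n. \<integral>\<^sup>+x. partial_sum n x \<partial>M)"
    unfolding series_def using partial_sum_mono
    by (intro nn_integral_monotone_convergence_SUP) (auto simp: incseq_def le_fun_def)
  also have "\<dots> \<le> 1" using bound by (rule SUP_least)
  finally obtain a where a: "(\<integral>\<^sup>+x. series x \<partial>M) = ennreal a" "0 \<le> a"
    by (cases "\<integral>\<^sup>+x. series x \<partial>M") (auto simp: top_unique)
  obtain b where b: "(\<integral>\<^sup>+x. residual series x \<partial>M) = ennreal b" "0 \<le> b"
    using residual_integral[of series] a by (cases "\<integral>\<^sup>+x. residual series x \<partial>M") auto
  have "b + e * a = a"
    using residual_integral[of series] a b e by (simp flip: ennreal_mult ennreal_plus)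
  moreover have "(\<integral>\<^sup>+x. series x \<partial>M) = (\<integral>\<^sup>+x. minorant x + residual series x \<partial>M)"
    by (intro nn_integral_cong series_eq)
  then have "a = e + b"
    using a b e by (simp add: nn_integral_add flip: minorant_mass_def ennreal_plus)
  ultimately have "e * a = e" by simp
  then show ?thesis using a e by simp
qed

lemma step_add:
  assumes [measurable]: "f \<in> borel_measurable M" "g \<in> borel_measurable M" "x \<in> space M"
  shows "step (\<lambda>s. c * (f s + g s)) x = c * (step f x + step g x)"
proof -
  have "step (\<lambda>s. c * (f s + g s)) x = (\<integral>\<^sup>+s. c * (k s x * f s + k s x * g s) \<partial>M)"
    unfolding step_def by (simp add: distrib_left mult.left_commute)
  also have "\<dots> = c * (step f x + step g x)"
    unfolding step_def by (simp add: nn_integral_cmult nn_integral_add)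
  finally show ?thesis .
qed

text \<open>
  A density invariant under two steps need not be invariant under one step as a function, but its
  average with its image is.
\<close>

lemma invariant_density_exists:
  obtains f where "f \<in> borel_measurable M" "(\<integral>\<^sup>+x. f x \<partial>M) = 1"
    "\<And>x. x \<in> space M \<Longrightarrow> step f x = f x"
proof
  let ?f = "\<lambda>x. ennreal (1/2) * (series x + step series x)"
  show "?f \<in> borel_measurable M" by measurable
  have "(\<integral>\<^sup>+x. ?f x \<partial>M) = ennreal (1/2) + ennreal (1/2)"
    by (subst nn_integral_cmult)
       (measurable, simp add: nn_integral_add step_integral series_integral distrib_left del: one_add_one)
  also have "\<dots> = 1"
    by (subst ennreal_plus[symmetric]) auto
  finally show "(\<integral>\<^sup>+x. ?f x \<partial>M) = 1" .
  fix x assume [measurable]: "x \<in> space M"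
  have "step (step series) x = residual series x + minorant x"
    using step_step_eq_residual[OF series_measurable \<open>x \<in> space M\<close>] by (simp add: series_integral)
  also have "\<dots> = series x" using series_eq[OF \<open>x \<in> space M\<close>] by (metis add.commute)
  finally show "step ?f x = ?f x" by (simp only: step_add[OF series_measurable step_measurable[OF series_measurable] \<open>x \<in> space M\<close>] add.commute)
qed

lemma invariant_density_unique:
  assumes [measurable]: "f \<in> borel_measurable M" "g \<in> borel_measurable M"
    and "\<And>x. x \<in> space M \<Longrightarrow> step f x = f x" "\<And>x. x \<in> space M \<Longrightarrow> step g x = g x"
    and "(\<integral>\<^sup>+x. f x \<partial>M) = 1" "(\<integral>\<^sup>+x. g x \<partial>M) = 1"
  shows "AE x in M. f x = g x"
proof -
  have "AE x in M. f x = series x"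
    if [measurable]: "f \<in> borel_measurable M" and fx: "\<And>x. x \<in> space M \<Longrightarrow> step f x = f x"
      and int: "(\<integral>\<^sup>+x. f x \<partial>M) = 1" for f
  proof -
    have le: "series x \<le> f x" if "x \<in> space M" for x
      using that fx int by (intro series_least) auto
    have "AE x in M. f x \<le> series x"
      using nn_integral_less[of series M f] le by (auto simp: int series_integral)
    with AE_space show ?thesis
      by eventually_elim (use le in \<open>auto intro: antisym\<close>)
  qed
  from this[of f] this[of g] show ?thesis using assms by auto
qed

end

section \<open>The chain that jumps to the farther of two samples\<close>

text \<open>
  Twice the probability that a sample at distance \<^term>\<open>u\<close> is chosen when the competing sample is at
  distance \<^term>\<open>v\<close>; a tie gives weight 1. The factor 2 is absorbed by the choice of which of the two
  samples is the one jumped to, so that integrating over the competitor gives the transition density.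
\<close>

definition farther_weight :: "real \<Rightarrow> real \<Rightarrow> ennreal" where
  "farther_weight u v = of_bool (v < u) + of_bool (v \<le> u)"

lemma farther_weight_sum: "farther_weight u v + farther_weight v u = 2"
  by (auto simp: farther_weight_def)

lemma farther_weight_measurable[measurable]:
  assumes [measurable]: "f \<in> borel_measurable N" "g \<in> borel_measurable N"
  shows "(\<lambda>x. farther_weight (f x) (g x)) \<in> borel_measurable N"
  unfolding farther_weight_def by measurable

locale farther_chain = prob_space \<theta>
  for \<theta> :: "'a::{metric_space, second_countable_topology} measure" +
  assumes id_measurable: "(\<lambda>x. x) \<in> borel_measurable \<theta>"
begin

sublocale pair: pair_sigma_finite \<theta> \<theta> ..

lemma dist_measurable[measurable]: "(\<lambda>(x, y). dist x y) \<in> borel_measurable (\<theta> \<Otimes>\<^sub>M \<theta>)"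
proof -
  have "(\<lambda>p. dist (fst p) (snd p)) \<in> borel_measurable (\<theta> \<Otimes>\<^sub>M \<theta>)"
    by (intro borel_measurable_dist measurable_compose[OF measurable_fst id_measurable]
        measurable_compose[OF measurable_snd id_measurable])
  then show ?thesis by (simp add: case_prod_beta)
qed

definition jump_density :: "'a \<Rightarrow> 'a \<Rightarrow> ennreal" where
  "jump_density s x = (\<integral>\<^sup>+y. farther_weight (dist s x) (dist s y) \<partial>\<theta>)"

lemma jump_density_measurable[measurable]:
  "case_prod jump_density \<in> borel_measurable (\<theta> \<Otimes>\<^sub>M \<theta>)"
  unfolding jump_density_def[abs_def] by measurable

lemma jump_density_integral:
  assumes [measurable]: "s \<in> space \<theta>"
  shows "(\<integral>\<^sup>+x. jump_density s x \<partial>\<theta>) = 1"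
proof -
  let ?w = "\<lambda>x y. farther_weight (dist s x) (dist s y)"
  let ?I = "\<integral>\<^sup>+x. \<integral>\<^sup>+y. ?w x y \<partial>\<theta> \<partial>\<theta>"
  have "(\<integral>\<^sup>+x. \<integral>\<^sup>+y. ?w y x \<partial>\<theta> \<partial>\<theta>) = (\<integral>\<^sup>+y. \<integral>\<^sup>+x. ?w y x \<partial>\<theta> \<partial>\<theta>)"
    by (rule pair.Fubini') measurable
  then have "?I + ?I = ?I + (\<integral>\<^sup>+x. \<integral>\<^sup>+y. ?w y x \<partial>\<theta> \<partial>\<theta>)" by simp
  also have "\<dots> = (\<integral>\<^sup>+x. \<integral>\<^sup>+y. ?w x y + ?w y x \<partial>\<theta> \<partial>\<theta>)"
    by (simp add: nn_integral_add)
  also have "\<dots> = 2"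
    by (simp add: farther_weight_sum emeasure_space_1)
  finally have "2 * ?I = 2 * 1" by (simp add: mult_2)
  then have "?I = 1" by (subst (asm) ennreal_mult_cancel_left) auto
  then show ?thesis by (simp add: jump_density_def)
qed

text \<open>
  If \<open>B\<close> is the set of targets with density below 1/8, a point of \<open>B\<close> has less than 1/8 of
  the mass at most as far from \<^term>\<open>s\<close> as itself. Ranking \<open>B\<close> by the distance from
  \<^term>\<open>s\<close>, the square of the mass of \<open>B\<close> is at most 2/8 of that mass.
\<close>

lemma jump_density_spread:
  assumes [measurable]: "s \<in> space \<theta>"
  shows "emeasure \<theta> {x\<in>space \<theta>. jump_density s x < ennreal (1/8)} \<le> ennreal (1/4)"
proof -
  let ?B = "{x\<in>space \<theta>. jump_density s x < ennreal (1/8)}"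
  have "emeasure \<theta> ?B * emeasure \<theta> ?B
      \<le> 2 * (\<integral>\<^sup>+x\<in>?B. emeasure \<theta> {y\<in>?B. dist s y \<le> dist s x} \<partial>\<theta>)"
    by (rule measure_square_le_rank) measurable
  also have "\<dots> \<le> 2 * (\<integral>\<^sup>+x\<in>?B. ennreal (1/8) \<partial>\<theta>)"
  proof (intro mult_left_mono nn_integral_mono)
    fix x assume [measurable]: "x \<in> space \<theta>"
    have "emeasure \<theta> {y\<in>?B. dist s y \<le> dist s x} \<le> emeasure \<theta> {y\<in>space \<theta>. dist s y \<le> dist s x}"
      by (intro emeasure_mono) auto
    also have "\<dots> = (\<integral>\<^sup>+y. of_bool (dist s y \<le> dist s x) \<partial>\<theta>)"
      by (rule emeasure_Collect_eq_nn_integral) measurable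
    also have "\<dots> \<le> jump_density s x"
      unfolding jump_density_def farther_weight_def by (intro nn_integral_mono) auto
    finally show "emeasure \<theta> {y\<in>?B. dist s y \<le> dist s x} * indicator ?B x
        \<le> ennreal (1/8) * indicator ?B x"
      by (auto simp: indicator_def)
  qed simp
  also have "\<dots> = 2 * (ennreal (1/8) * emeasure \<theta> ?B)"
    by (subst nn_integral_cmult_indicator) measurable
  finally have "prob ?B * prob ?B \<le> 2 * (1/8 * prob ?B)"
    unfolding emeasure_eq_measure
    by (simp only: ennreal_numeral[symmetric] ennreal_mult[symmetric] measure_nonneg ennreal_le_iff zero_le_numeral zero_le_divide_1_iff mult_nonneg_nonneg)
  then have "prob ?B \<le> 1/4"
    using mult_le_cancel_left_pos[of "prob ?B" "4 * prob ?B" 1]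
    by (cases "prob ?B = 0") (auto simp: zero_less_measure_iff)
  then show ?thesis unfolding emeasure_eq_measure by (rule ennreal_leI)
qed

sublocale spread_kernel \<theta> jump_density "ennreal (1/8)"
  by unfold_locales (auto simp: jump_density_integral jump_density_spread)

end

lemma jth_nearest_2_2:
  "jth_nearest 2 2 s x =
    (if dist s (x 1) < dist s (x 0) then {0} else if dist s (x 0) < dist s (x 1) then {1} else {0, 1})"
proof -
  have two: "{..<2::nat} = {0, 1}" by auto
  have C: "{l \<in> {0, 1::nat}. P l} = (if P 0 then {0} else {}) \<union> (if P 1 then {1} else {})" for P
    by (simp add: set_eq_iff) (metis neq0_conv)
  show ?thesis
    unfolding jth_nearest_def two by (simp only: C) (auto simp: card_insert_if split: if_splits)
qed

lemma uniform_jth_nearest_2_2_prob: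
  assumes "x \<in> {..<2::nat} \<rightarrow> space \<theta>"
  shows "x \<in> uniform_count_measure (jth_nearest 2 2 s x) \<rightarrow>\<^sub>M \<theta>"
    and "prob_space (distr (uniform_count_measure (jth_nearest 2 2 s x)) \<theta> x)"
proof -
  show *: "x \<in> uniform_count_measure (jth_nearest 2 2 s x) \<rightarrow>\<^sub>M \<theta>"
    using assms
    by (auto simp: measurable_def sets_uniform_count_measure space_uniform_count_measure
        jth_nearest_2_2 split: if_splits)
  have "prob_space (uniform_count_measure (jth_nearest 2 2 s x))"
    by (rule prob_space_uniform_count_measure) (auto simp: jth_nearest_2_2)
  then show "prob_space (distr (uniform_count_measure (jth_nearest 2 2 s x)) \<theta> x)"
    using * by (rule prob_space.prob_space_distr)
qed

lemma emeasure_uniform_jth_nearest_2_2: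
  assumes "x \<in> {..<2::nat} \<rightarrow> space \<theta>" "A \<in> sets \<theta>"
  shows "emeasure (distr (uniform_count_measure (jth_nearest 2 2 s x)) \<theta> x) A =
    ennreal (1/2) * (farther_weight (dist s (x 0)) (dist s (x 1)) * indicator A (x 0) +
           farther_weight (dist s (x 1)) (dist s (x 0)) * indicator A (x 1))"
proof -
  let ?J = "jth_nearest 2 2 s x"
  have "emeasure (distr (uniform_count_measure ?J) \<theta> x) A = emeasure (uniform_count_measure ?J) (x -` A \<inter> ?J)"
    using assms(2) uniform_jth_nearest_2_2_prob(1)[OF assms(1)]
    by (subst emeasure_distr) (auto simp: space_uniform_count_measure)
  also have "\<dots> = ennreal (real (card (x -` A \<inter> ?J)) / card ?J)"
    by (subst emeasure_uniform_count_measure) (auto simp: jth_nearest_2_2)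
  also have "\<dots> = ennreal (1/2 * ((of_bool (dist s (x 1) < dist s (x 0)) + of_bool (dist s (x 1) \<le> dist s (x 0))) * indicator A (x 0) +
           (of_bool (dist s (x 0) < dist s (x 1)) + of_bool (dist s (x 0) \<le> dist s (x 1))) * indicator A (x 1)))"
    by (intro arg_cong[where f=ennreal], cases "x 0 \<in> A"; cases "x 1 \<in> A";
        cases "dist s (x 0)" "dist s (x 1)" rule: linorder_cases)
       (simp_all add: jth_nearest_2_2 Int_insert_right)
  also have "\<dots> = ennreal (1/2) * (farther_weight (dist s (x 0)) (dist s (x 1)) * indicator A (x 0) +
           farther_weight (dist s (x 1)) (dist s (x 0)) * indicator A (x 1))"
    unfolding farther_weight_def
    by (subst ennreal_mult, simp, simp) (auto simp: indicator_def ennreal_plus[symmetric] simp del: ennreal_plus)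
  finally show ?thesis .
qed

context farther_chain begin

lemma farther_choice_kernel:
  "(\<lambda>x. distr (uniform_count_measure (jth_nearest 2 2 s x)) \<theta> x)
    \<in> (\<Pi>\<^sub>M i\<in>{..<2}. \<theta>) \<rightarrow>\<^sub>M prob_algebra \<theta>" if [measurable]: "s \<in> space \<theta>"
proof (intro measurable_prob_algebraI measurable_subprob_algebra)
  have sp: "x \<in> {..<2} \<rightarrow> space \<theta>" if "x \<in> space (\<Pi>\<^sub>M i\<in>{..<2}. \<theta>)" for x :: "nat \<Rightarrow> 'a"
    using that by (auto simp: space_PiM)
  show pr: "prob_space (distr (uniform_count_measure (jth_nearest 2 2 s x)) \<theta> x)"
    if "x \<in> space (\<Pi>\<^sub>M i\<in>{..<2}. \<theta>)" for x
    using uniform_jth_nearest_2_2_prob(2)[OF sp[OF that]] .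
  show "subprob_space (distr (uniform_count_measure (jth_nearest 2 2 s x)) \<theta> x)"
    if "x \<in> space (\<Pi>\<^sub>M i\<in>{..<2}. \<theta>)" for x
    using pr[OF that] by (rule prob_space_imp_subprob_space)
  fix A assume A[measurable]: "A \<in> sets \<theta>"
  have [measurable]: "(\<lambda>x. x 0) \<in> (\<Pi>\<^sub>M i\<in>{..<2::nat}. \<theta>) \<rightarrow>\<^sub>M \<theta>" "(\<lambda>x. x 1) \<in> (\<Pi>\<^sub>M i\<in>{..<2::nat}. \<theta>) \<rightarrow>\<^sub>M \<theta>"
    by (auto intro!: measurable_component_singleton)
  have "(\<lambda>x. ennreal (1/2) * (farther_weight (dist s (x 0)) (dist s (x 1)) * indicator A (x 0) +
       farther_weight (dist s (x 1)) (dist s (x 0)) * indicator A (x 1)))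
    \<in> borel_measurable (\<Pi>\<^sub>M i\<in>{..<2::nat}. \<theta>)" by measurable
  then show "(\<lambda>x. emeasure (distr (uniform_count_measure (jth_nearest 2 2 s x)) \<theta> x) A)
    \<in> borel_measurable (\<Pi>\<^sub>M i\<in>{..<2}. \<theta>)"
    by (rule measurable_cong[THEN iffD2, rotated]) (rule emeasure_uniform_jth_nearest_2_2[OF sp A])
qed simp

lemma emeasure_jump:
  assumes [measurable]: "s \<in> space \<theta>" "A \<in> sets \<theta>"
  shows "emeasure (jump 2 2 \<theta> s) A = (\<integral>\<^sup>+x\<in>A. jump_density s x \<partial>\<theta>)"
proof -
  let ?P = "\<Pi>\<^sub>M i\<in>{..<2::nat}. \<theta>"
  let ?w = "\<lambda>x y. farther_weight (dist s x) (dist s y)"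
  let ?F = "\<lambda>x y. ennreal (1/2) * (?w x y * indicator A x + ?w y x * indicator A y)"
  have F: "case_prod ?F \<in> borel_measurable (\<theta> \<Otimes>\<^sub>M \<theta>)" by measurable
  note nn_integral_F = nn_integral_fst[OF F]
  interpret product_sigma_finite "\<lambda>_. \<theta>" ..
  interpret P: prob_space ?P by (intro prob_space_PiM) unfold_locales
  have two: "{..<2::nat} = {0, 1}" by auto
  have "emeasure (jump 2 2 \<theta> s) A =
      (\<integral>\<^sup>+x. emeasure (distr (uniform_count_measure (jth_nearest 2 2 s x)) \<theta> x) A \<partial>?P)"
    unfolding jump_def
    by (intro emeasure_bind_prob_algebra[OF _ farther_choice_kernel assms(2)] assms(1))
       (simp add: space_prob_algebra P.prob_space_axioms)
  also have "\<dots> = (\<integral>\<^sup>+x. ?F (x 0) (x 1) \<partial>?P)"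
    by (intro nn_integral_cong emeasure_uniform_jth_nearest_2_2 assms(2)) (auto simp: space_PiM)
  also have "\<dots> = (\<integral>\<^sup>+z. ?F (fst z) (snd z) \<partial>(\<theta> \<Otimes>\<^sub>M \<theta>))"
    unfolding two by (rule product_nn_integral_pair[where f="?F", OF F]) simp
  also have "\<dots> = (\<integral>\<^sup>+x. \<integral>\<^sup>+y. ?F x y \<partial>\<theta> \<partial>\<theta>)"
    using nn_integral_F by (simp add: case_prod_unfold)
  also have "\<dots> = ennreal (1/2) * ((\<integral>\<^sup>+x. \<integral>\<^sup>+y. ?w x y * indicator A x \<partial>\<theta> \<partial>\<theta>) +
       (\<integral>\<^sup>+x. \<integral>\<^sup>+y. ?w y x * indicator A y \<partial>\<theta> \<partial>\<theta>))"
    by (simp add: nn_integral_add nn_integral_cmult)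
  also have "(\<integral>\<^sup>+x. \<integral>\<^sup>+y. ?w y x * indicator A y \<partial>\<theta> \<partial>\<theta>) = (\<integral>\<^sup>+y. \<integral>\<^sup>+x. ?w y x * indicator A y \<partial>\<theta> \<partial>\<theta>)"
    by (rule pair.Fubini') measurable
  also have "(\<integral>\<^sup>+x. \<integral>\<^sup>+y. ?w x y * indicator A x \<partial>\<theta> \<partial>\<theta>) = (\<integral>\<^sup>+x\<in>A. jump_density s x \<partial>\<theta>)"
    unfolding jump_density_def by (intro nn_integral_cong nn_integral_multc) measurable
  also have "ennreal (1/2) * (a + a) = a" for a
  proof -
    have "ennreal (1/2) * (a + a) = (ennreal (1/2) + ennreal (1/2)) * a"
      by (simp only: distrib_left distrib_right)
    also have "ennreal (1/2) + ennreal (1/2) = 1"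
      by (subst ennreal_plus[symmetric]) auto
    finally show ?thesis by simp
  qed
  finally show ?thesis .
qed

text \<open>
  The defining equation of a stationary distribution uses the monadic bind, which has its intended
  meaning only for measurable kernels.
\<close>

lemma jump_kernel: "jump 2 2 \<theta> \<in> \<theta> \<rightarrow>\<^sub>M prob_algebra \<theta>"
proof (intro measurable_prob_algebraI measurable_subprob_algebra)
  interpret P: prob_space "\<Pi>\<^sub>M i\<in>{..<2::nat}. \<theta>" by (intro prob_space_PiM) unfold_locales
  have P: "(\<Pi>\<^sub>M i\<in>{..<2::nat}. \<theta>) \<in> space (prob_algebra (\<Pi>\<^sub>M i\<in>{..<2::nat}. \<theta>))"
    by (simp add: space_prob_algebra P.prob_space_axioms)
  fix s assume [measurable]: "s \<in> space \<theta>"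
  show pr: "prob_space (jump 2 2 \<theta> s)"
    unfolding jump_def by (rule prob_space_bind'[OF P farther_choice_kernel]) fact
  show "sets (jump 2 2 \<theta> s) = sets \<theta>"
    unfolding jump_def by (rule sets_bind'[OF P farther_choice_kernel]) fact
  show "subprob_space (jump 2 2 \<theta> s)"
    using pr by (rule prob_space_imp_subprob_space)
next
  fix A assume [measurable]: "A \<in> sets \<theta>"
  have "(\<lambda>s. \<integral>\<^sup>+x\<in>A. jump_density s x \<partial>\<theta>) \<in> borel_measurable \<theta>" by measurable
  then show "(\<lambda>s. emeasure (jump 2 2 \<theta> s) A) \<in> borel_measurable \<theta>"
    by (rule measurable_cong[THEN iffD2, rotated]) (rule emeasure_jump[OF _ \<open>A \<in> sets \<theta>\<close>])
qed

definition next_density :: "'a measure \<Rightarrow> 'a \<Rightarrow> ennreal" where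
  "next_density \<mu> x = (\<integral>\<^sup>+s. jump_density s x \<partial>\<mu>)"

lemma next_density_measurable:
  assumes "prob_space \<mu>" and [measurable_cong]: "sets \<mu> = sets \<theta>"
  shows "next_density \<mu> \<in> borel_measurable \<theta>"
proof -
  interpret m: prob_space \<mu> by fact
  show ?thesis unfolding next_density_def[abs_def] by measurable
qed

lemma bind_jump:
  assumes "prob_space \<mu>" and [measurable_cong]: "sets \<mu> = sets \<theta>"
  shows "\<mu> \<bind> jump 2 2 \<theta> = density \<theta> (next_density \<mu>)"
proof (rule measure_eqI)
  interpret m: prob_space \<mu> by fact
  interpret mt: pair_sigma_finite \<mu> \<theta> ..
  have mu: "\<mu> \<in> space (prob_algebra \<theta>)" using assms by (simp add: space_prob_algebra)
  show sets_eq: "sets (\<mu> \<bind> jump 2 2 \<theta>) = sets (density \<theta> (next_density \<mu>))"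
    using sets_bind'[OF mu jump_kernel] by simp
  fix A assume "A \<in> sets (\<mu> \<bind> jump 2 2 \<theta>)"
  then have [measurable]: "A \<in> sets \<theta>" using sets_eq by simp
  have "emeasure (\<mu> \<bind> jump 2 2 \<theta>) A = (\<integral>\<^sup>+s. emeasure (jump 2 2 \<theta> s) A \<partial>\<mu>)"
    by (rule emeasure_bind_prob_algebra[OF mu jump_kernel]) fact
  also have "\<dots> = (\<integral>\<^sup>+s. \<integral>\<^sup>+x. jump_density s x * indicator A x \<partial>\<theta> \<partial>\<mu>)"
    using sets_eq_imp_space_eq[OF assms(2)] by (intro nn_integral_cong emeasure_jump) auto
  also have "\<dots> = (\<integral>\<^sup>+x. \<integral>\<^sup>+s. jump_density s x * indicator A x \<partial>\<mu> \<partial>\<theta>)"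
    by (rule mt.Fubini'[symmetric]) measurable
  also have "\<dots> = (\<integral>\<^sup>+x. next_density \<mu> x * indicator A x \<partial>\<theta>)"
    unfolding next_density_def by (intro nn_integral_cong nn_integral_multc) measurable
  also have "\<dots> = emeasure (density \<theta> (next_density \<mu>)) A"
    using next_density_measurable[OF assms] by (simp add: emeasure_density)
  finally show "emeasure (\<mu> \<bind> jump 2 2 \<theta>) A = emeasure (density \<theta> (next_density \<mu>)) A" .
qed

lemma stationary_iff:
  "stationary 2 2 \<theta> \<mu> \<longleftrightarrow> prob_space \<mu> \<and> sets \<mu> = sets \<theta> \<and> \<mu> = density \<theta> (next_density \<mu>)"
  unfolding stationary_def space_prob_algebra using bind_jump by auto

lemma next_density_density:
  assumes [measurable]: "f \<in> borel_measurable \<theta>" and [measurable]: "x \<in> space \<theta>"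
  shows "next_density (density \<theta> f) x = step f x"
  unfolding next_density_def step_def
  by (subst nn_integral_density) (measurable, simp add: mult.commute)

text \<open>
  A stationary measure \<open>\<mu>\<close> has the density \<^term>\<open>next_density \<mu>\<close>. This version of the density is fixed
  by \<^const>\<open>step\<close> at every point and not only almost everywhere, as required for comparing it with
  the invariant densities above.
\<close>

lemma stationary_unique: "\<exists>!\<mu>. stationary 2 2 \<theta> \<mu>"
proof -
  have prob_density: "prob_space (density \<theta> f) \<longleftrightarrow> (\<integral>\<^sup>+x. f x \<partial>\<theta>) = 1"
    if [measurable]: "f \<in> borel_measurable \<theta>" for f
  proof -
    have "emeasure (density \<theta> f) (space (density \<theta> f)) = (\<integral>\<^sup>+x. f x \<partial>\<theta>)"
      by (simp add: emeasure_density cong: nn_integral_cong)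
    then show ?thesis by (metis prob_spaceI prob_space.emeasure_space_1)
  qed
  obtain f where [measurable]: "f \<in> borel_measurable \<theta>" and f_int: "(\<integral>\<^sup>+x. f x \<partial>\<theta>) = 1"
    and f_fix: "\<And>x. x \<in> space \<theta> \<Longrightarrow> step f x = f x"
    by (rule invariant_density_exists) blast
  show ?thesis
  proof (rule ex1I)
    have "prob_space (density \<theta> f)" by (simp add: prob_density f_int)
    moreover from this have "density \<theta> f = density \<theta> (next_density (density \<theta> f))"
      using f_fix by (intro density_cong)
       (auto simp: next_density_density intro!: next_density_measurable)
    ultimately show "stationary 2 2 \<theta> (density \<theta> f)"
      by (simp add: stationary_iff)
  next
    fix \<mu> assume mu: "stationary 2 2 \<theta> \<mu>"
    then have pr: "prob_space \<mu>" "sets \<mu> = sets \<theta>" and eq: "density \<theta> (next_density \<mu>) = \<mu>"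
      by (simp_all add: stationary_iff)
    have [measurable]: "next_density \<mu> \<in> borel_measurable \<theta>"
      using pr by (rule next_density_measurable)
    have "step (next_density \<mu>) x = next_density \<mu> x" if "x \<in> space \<theta>" for x
      using next_density_density[of "next_density \<mu>" x] that by (simp add: eq)
    moreover have "(\<integral>\<^sup>+x. next_density \<mu> x \<partial>\<theta>) = 1"
      using prob_density[of "next_density \<mu>"] pr by (simp add: eq)
    ultimately have "AE x in \<theta>. next_density \<mu> x = f x"
      using f_int f_fix by (intro invariant_density_unique) auto
    then have "density \<theta> (next_density \<mu>) = density \<theta> f"
      by (intro density_cong) auto
    then show "\<mu> = density \<theta> f" by (simp add: eq)
  qed
qed

lemma self_stationary_imp_unit_density:
  assumes "stationary 2 2 \<theta> \<theta>"
  shows "AE x in \<theta>. next_density \<theta> x = 1"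
proof -
  have "density \<theta> (next_density \<theta>) = density \<theta> (\<lambda>x. 1)"
    using assms by (simp add: stationary_iff density_1)
  moreover have "next_density \<theta> \<in> borel_measurable \<theta>"
    by (rule next_density_measurable) (simp_all add: prob_space_axioms)
  ultimately show ?thesis
    using density_unique_iff[of "next_density \<theta>" "\<lambda>x. 1"] by simp
qed

end

lemma (in prob_space) rank_integral_ge:
  fixes R :: "'a \<Rightarrow> real"
  assumes [measurable]: "R \<in> borel_measurable M" "B \<in> sets M"
  shows "(prob B)\<^sup>2 \<le> 2 * (\<integral>s. indicator B s * prob {y\<in>B. R y \<le> R s} \<partial>M)"
proof -
  let ?g = "\<lambda>s. indicator B s * prob {y\<in>B. R y \<le> R s}"
  have "(\<lambda>s. enn2real (\<integral>\<^sup>+y. of_bool (y \<in> B \<and> R y \<le> R s) \<partial>M)) \<in> borel_measurable M"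
    by measurable
  moreover have "prob {y\<in>B. R y \<le> R s} = enn2real (\<integral>\<^sup>+y. of_bool (y \<in> B \<and> R y \<le> R s) \<partial>M)" for s
  proof -
    have "{y\<in>B. R y \<le> R s} = {y\<in>space M. y \<in> B \<and> R y \<le> R s}"
      using sets.sets_into_space[OF assms(2)] by auto
    then show ?thesis by (simp add: measure_def emeasure_Collect_eq_nn_integral)
  qed
  ultimately have [measurable]: "(\<lambda>s. prob {y\<in>B. R y \<le> R s}) \<in> borel_measurable M" by simp
  have int: "integrable M ?g"
    by (rule integrable_const_bound[where B=1]) (auto simp: indicator_def)
  have "ennreal ((prob B)\<^sup>2) = emeasure M B * emeasure M B"
    by (simp add: emeasure_eq_measure power2_eq_square ennreal_mult)
  also have "\<dots> \<le> 2 * (\<integral>\<^sup>+s. ennreal (?g s) \<partial>M)"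
    using measure_square_le_rank[OF assms]
    by (simp add: emeasure_eq_measure ennreal_mult mult.commute ennreal_indicator)
  also have "\<dots> = ennreal (2 * (\<integral>s. ?g s \<partial>M))"
    using int by (subst nn_integral_eq_integral) (auto simp: ennreal_mult)
  finally show ?thesis
    by (subst (asm) ennreal_le_iff) (auto intro!: integral_nonneg)
qed

section \<open>Balanced distributions on the line\<close>

context real_distribution begin

definition nearer :: "real \<Rightarrow> real \<Rightarrow> real" where
  "nearer s x = prob {y. \<bar>y - s\<bar> < \<bar>x - s\<bar>}"

definition as_near :: "real \<Rightarrow> real \<Rightarrow> real" where
  "as_near s x = prob {y. \<bar>y - s\<bar> \<le> \<bar>x - s\<bar>}"

lemma prob_section_measurable:
  assumes [measurable]: "Measurable.pred (N \<Otimes>\<^sub>M borel) (\<lambda>p. P (fst p) (snd p))"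
  shows "(\<lambda>z. prob {y. P z y}) \<in> borel_measurable N"
proof -
  have "(\<lambda>z. enn2real (\<integral>\<^sup>+y. of_bool (P z y) \<partial>M)) \<in> borel_measurable N"
    by measurable
  moreover have "prob {y. P z y} = enn2real (\<integral>\<^sup>+y. of_bool (P z y) \<partial>M)" if "z \<in> space N" for z
  proof -
    have "Measurable.pred borel (P z)"
      using measurable_compose[OF measurable_Pair1'[OF that] assms] by simp
    then have "{y. P z y} \<in> sets borel" by (simp add: pred_def)
    then show ?thesis
      using emeasure_Collect_eq_nn_integral[of M "P z"] by (simp add: measure_def)
  qed
  ultimately show ?thesis by (simp cong: measurable_cong)
qed

lemma nearer_measurable[measurable]: "(\<lambda>s. nearer s x) \<in> borel_measurable borel"
  unfolding nearer_def by (rule prob_section_measurable) measurable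

lemma as_near_measurable[measurable]: "(\<lambda>s. as_near s x) \<in> borel_measurable borel"
  unfolding as_near_def by (rule prob_section_measurable) measurable

lemma integrable_bounded:
  fixes f :: "real \<Rightarrow> real"
  assumes "f \<in> borel_measurable borel" "\<And>s. \<bar>f s\<bar> \<le> C"
  shows "integrable M f"
  using assms by (intro integrable_const_bound[where B=C]) auto

lemma nearer_integrable: "integrable M (\<lambda>s. nearer s x)"
  by (rule integrable_bounded[where C=1]) (auto simp: nearer_def)

lemma as_near_integrable: "integrable M (\<lambda>s. as_near s x)"
  by (rule integrable_bounded[where C=1]) (auto simp: as_near_def)

lemma nearer_le_as_near: "nearer s x \<le> as_near s x"
  unfolding nearer_def as_near_def by (intro finite_measure_mono) auto

text \<open>
  The jump density towards \<^term>\<open>x\<close>, averaged over sources drawn from the distribution itself, is 1.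
\<close>

definition balanced_at :: "real \<Rightarrow> bool" where
  "balanced_at x \<longleftrightarrow> (\<integral>s. nearer s x + as_near s x \<partial>M) = 1"

definition in_support :: "real \<Rightarrow> bool" where
  "in_support a \<longleftrightarrow> (\<forall>\<delta>>0. 0 < prob {a-\<delta><..<a+\<delta>})"

lemma AE_meets:
  assumes "AE x in M. P x" "0 < prob A" 
  obtains x where "x \<in> A" "P x"
proof -
  have "A \<in> events" using assms(2) measure_notin_sets[of A M] by fastforce
  then have "\<not> (AE x in M. x \<notin> A)" using assms(2) prob_eq_0[of A] by simp
  then have "\<exists>x\<in>A. P x"
    using assms(1) by (metis (mono_tags, lifting) eventually_mono)
  with that show ?thesis by blast
qed

text \<open>
  The endpoints of the support need not be atoms, so the balance equation may fail there. It holds at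
  points arbitrarily close to \<^term>\<open>a\<close>, and the strict inequality between distances is stable under
  small shifts of \<^term>\<open>a\<close>; only the half of the equation that comes from strict inequalities
  survives in the limit.
\<close>

lemma nearer_integral_le:
  assumes "AE x in M. balanced_at x" "in_support a"
  shows "2 * (\<integral>s. nearer s a \<partial>M) \<le> 1"
proof -
  \<comment> \<open>The strict inequality with a margin, which is inherited by all points within the margin of \<^term>\<open>a\<close>.\<close>
  define U where "U = (\<lambda>n s. prob {y. \<bar>y - s\<bar> < \<bar>a - s\<bar> - 1 / real (Suc n)})"
  have U_meas[measurable]: "U n \<in> borel_measurable borel" for n
    unfolding U_def by (rule prob_section_measurable) measurable
  have U_int: "integrable M (U n)" for n
    by (rule integrable_bounded[where C=1]) (auto simp: U_def)
  have "2 * (\<integral>s. U n s \<partial>M) \<le> 1" for n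
  proof -
    have "0 < prob {a - 1 / real (Suc n)<..<a + 1 / real (Suc n)}"
      using assms(2) unfolding in_support_def by simp
    then obtain x where x: "x \<in> {a - 1 / real (Suc n)<..<a + 1 / real (Suc n)}" "balanced_at x"
      using AE_meets[OF assms(1)] by blast
    have "U n s \<le> nearer s x" for s
      unfolding U_def nearer_def using x(1) by (intro finite_measure_mono) auto
    then have "2 * U n s \<le> nearer s x + as_near s x" for s
      using nearer_le_as_near[of s x] by (smt (verit))
    then have "(\<integral>s. 2 * U n s \<partial>M) \<le> (\<integral>s. nearer s x + as_near s x \<partial>M)"
      by (intro integral_mono Bochner_Integration.integrable_add nearer_integrable as_near_integrable
          integrable_mult_right U_int)
    then show ?thesis using x(2) by (simp add: balanced_at_def)
  qed
  moreover have "(\<lambda>n. \<integral>s. U n s \<partial>M) \<longlonglongrightarrow> (\<integral>s. nearer s a \<partial>M)"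
  proof (rule integral_dominated_convergence[where w="\<lambda>_. 1"])
    show "AE s in M. (\<lambda>n. U n s) \<longlonglongrightarrow> nearer s a"
    proof (rule AE_I2)
      fix s
      have "(\<lambda>n. U n s) \<longlonglongrightarrow> prob (\<Union>n. {y. \<bar>y - s\<bar> < \<bar>a - s\<bar> - 1 / real (Suc n)})"
        unfolding U_def
      proof (rule finite_Lim_measure_incseq)
        show "incseq (\<lambda>n. {y. \<bar>y - s\<bar> < \<bar>a - s\<bar> - 1 / real (Suc n)})"
          by (rule incseq_SucI) (auto elim!: less_le_trans simp: frac_le)
      qed auto
      also have "(\<Union>n. {y. \<bar>y - s\<bar> < \<bar>a - s\<bar> - 1 / real (Suc n)}) = {y. \<bar>y - s\<bar> < \<bar>a - s\<bar>}"
      proof (intro equalityI subsetI)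
        fix y assume "y \<in> {y. \<bar>y - s\<bar> < \<bar>a - s\<bar>}"
        then obtain n where "1 / real (Suc n) < \<bar>a - s\<bar> - \<bar>y - s\<bar>"
          using reals_Archimedean[of "\<bar>a - s\<bar> - \<bar>y - s\<bar>"] by (auto simp: inverse_eq_divide)
        then show "y \<in> (\<Union>n. {y. \<bar>y - s\<bar> < \<bar>a - s\<bar> - 1 / real (Suc n)})" 
          by (auto intro!: exI[of _ n])
      qed (auto elim!: less_le_trans)
      finally show "(\<lambda>n. U n s) \<longlonglongrightarrow> nearer s a" unfolding nearer_def .
    qed
  qed (auto simp: U_def nearer_def)
  ultimately show ?thesis
    by (intro LIMSEQ_le_const2[OF tendsto_mult_left]) auto
qed

lemma balanced_at_atom:
  assumes "AE x in M. balanced_at x" "0 < prob {a}"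
  shows "balanced_at a"
  using AE_meets[OF assms] by blast

text \<open>
  Bounds the jump density towards the left end \<^term>\<open>a\<close> from below, by the position of the source
  \<open>s\<close> relative to the midpoint \<^term>\<open>m\<close>. If \<open>s\<close> is to the right of \<^term>\<open>m\<close>, then \<^term>\<open>a\<close>
  is strictly farther from it than all other points of the support. At \<^term>\<open>m\<close> only \<^term>\<open>b\<close> ties
  with \<^term>\<open>a\<close>. If \<open>s\<close> is to the left of \<^term>\<open>m\<close>, the atom at \<^term>\<open>a\<close> contributes a tie, and the
  points strictly between \<^term>\<open>a\<close> and \<open>s\<close> are nearer to \<open>s\<close> than \<^term>\<open>a\<close>; averaged over \<open>s\<close>, they
  give the square term. The bound at \<^term>\<open>m\<close> is weaker when \<^term>\<open>a\<close> carries no mass, as then only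
  strict inequalities can be used.
\<close>

lemma endpoint_inequality:
  fixes a b m \<alpha> \<beta> :: real
  defines "m \<equiv> (a + b) / 2" and "\<alpha> \<equiv> prob {a}" and "\<beta> \<equiv> prob {b}"
  assumes bal: "AE x in M. balanced_at x" and supp: "in_support a"
    and hull: "AE s in M. s \<in> {a..b}" and ab: "a < b"
  shows "prob {m<..b} * (2 - \<alpha>) + prob {a..<m} * \<alpha>
      + prob {m} * (if \<alpha> = 0 then 2 - 2 * \<beta> else 2 - \<alpha> - \<beta>) + (prob {a<..<m})\<^sup>2 \<le> 1"
proof -
  define c where "c = (if \<alpha> = 0 then 2 - 2 * \<beta> else 2 - \<alpha> - \<beta>)"
  define w where "w = (\<lambda>s. prob {y\<in>{a<..<m}. y \<le> s})"
  define g where "g = (\<lambda>s. if \<alpha> = 0 then 2 * nearer s a else nearer s a + as_near s a)"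
  define L where "L = (\<lambda>s. indicator {m<..b} s * (2 - \<alpha>) + indicator {a..<m} s * \<alpha>
      + indicator {m} s * c + 2 * (indicator {a<..<m} s * w s))"
  have am: "a < m" "m < b" using ab by (auto simp: m_def)
  have \<alpha>0: "0 \<le> \<alpha>" by (simp add: \<alpha>_def)
  have full: "prob {a..b} = 1" using hull by (subst prob_eq_1) auto
  have "{a..b} = {a} \<union> {a<..b}" using ab by auto
  then have "prob {a..b} = \<alpha> + prob {a<..b}"
    unfolding \<alpha>_def by (simp add: finite_measure_Union del: insert_is_Un Un_insert_left)
  then have left_open: "prob {a<..b} = 1 - \<alpha>" using full by simp
  have "{a<..b} = {b} \<union> {a<..<b}" using ab by auto
  then have "prob {a<..b} = \<beta> + prob {a<..<b}"
    unfolding \<beta>_def by (simp add: finite_measure_Union del: insert_is_Un Un_insert_left)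
  then have both_open: "prob {a<..<b} = 1 - \<alpha> - \<beta>" using left_open by simp
  have w_meas[measurable]: "w \<in> borel_measurable borel"
    unfolding w_def by (rule prob_section_measurable) measurable
  have g_int: "integrable M g"
    unfolding g_def using nearer_integrable as_near_integrable by (cases "\<alpha> = 0") auto
  have g_le: "(\<integral>s. g s \<partial>M) \<le> 1"
  proof (cases "\<alpha> = 0")
    case True
    then show ?thesis using nearer_integral_le[OF bal supp] by (simp add: g_def)
  next
    case False
    then have "balanced_at a" using \<alpha>0 by (intro balanced_at_atom bal) (simp add: \<alpha>_def zero_less_measure_iff)
    then show ?thesis using False by (simp add: g_def balanced_at_def)
  qed
  have "L s \<le> g s" if s: "s \<in> {a..b}" for s
  proof -
    consider "s = a" | "a < s" "s < m" | "s = m" | "m < s" using s by fastforce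
    then show ?thesis
    proof cases
      case 1
      have "\<alpha> \<le> as_near s a" unfolding \<alpha>_def as_near_def by (intro finite_measure_mono) auto
      then show ?thesis using 1 am by (auto simp: L_def g_def nearer_def intro: add_increasing)
    next
      case 2
      have n: "w s \<le> nearer s a"
        unfolding w_def nearer_def using 2 by (intro finite_measure_mono) auto
      have "\<alpha> + w s = prob ({a} \<union> {y\<in>{a<..<m}. y \<le> s})"
        unfolding \<alpha>_def w_def by (subst finite_measure_Union) auto
      also have "\<dots> \<le> as_near s a"
        unfolding as_near_def using 2 by (intro finite_measure_mono) auto
      finally show ?thesis using 2 n by (auto simp: L_def g_def)
    next
      case 3
      have n: "1 - \<alpha> - \<beta> \<le> nearer s a"
        unfolding both_open[symmetric] nearer_def using 3
        by (intro finite_measure_mono) (auto simp: m_def field_simps abs_if)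
      have "1 \<le> as_near s a"
        unfolding full[symmetric] as_near_def using 3
        by (intro finite_measure_mono) (auto simp: m_def field_simps abs_if)
      then show ?thesis using 3 n by (auto simp: L_def g_def c_def)
    next
      case 4
      have n: "1 - \<alpha> \<le> nearer s a"
        unfolding left_open[symmetric] nearer_def using 4
        by (intro finite_measure_mono) (auto simp: m_def field_simps abs_if)
      have "1 \<le> as_near s a"
        unfolding full[symmetric] as_near_def using 4
        by (intro finite_measure_mono) (auto simp: m_def field_simps abs_if)
      then show ?thesis using 4 n s by (auto simp: L_def g_def)
    qed
  qed
  then have "AE s in M. L s \<le> g s" using hull by auto
  have w_int: "integrable M (\<lambda>s. indicator {a<..<m} s * w s)"
    by (rule integrable_bounded[where C=1]) (auto simp: w_def indicator_def)
  have ind_int: "integrable M (indicator A :: real \<Rightarrow> real)" if "A \<in> sets borel" for A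
    using that by (simp add: integrable_indicator_iff less_top[symmetric])
  have "(prob {a<..<m})\<^sup>2 \<le> 2 * (\<integral>s. indicator {a<..<m} s * w s \<partial>M)"
    unfolding w_def by (rule rank_integral_ge) auto
  moreover have "(\<integral>s. L s \<partial>M) = prob {m<..b} * (2 - \<alpha>) + prob {a..<m} * \<alpha>
      + prob {m} * c + 2 * (\<integral>s. indicator {a<..<m} s * w s \<partial>M)"
    unfolding L_def using w_int by (simp add: ind_int)
  moreover have "integrable M L"
    unfolding L_def using w_int by (simp add: ind_int)
  then have "(\<integral>s. L s \<partial>M) \<le> (\<integral>s. g s \<partial>M)"
    using g_int by (rule integral_mono_AE) fact
  ultimately show ?thesis using g_le unfolding c_def by linarith
qed


lemma in_support_interval:
  assumes "in_support x" "c < x" "x < d"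
  shows "0 < prob {c<..<d}"
proof -
  have "0 < prob {x - min (x - c) (d - x)<..<x + min (x - c) (d - x)}"
    using assms unfolding in_support_def by simp
  also have "\<dots> \<le> prob {c<..<d}" by (intro finite_measure_mono) auto
  finally show ?thesis .
qed

text \<open>
  The essential infimum: the supremum of the almost sure lower bounds. It is itself such a bound, as
  countably many smaller bounds approach it.
\<close>

lemma least_support_point:
  assumes "AE s in M. c \<le> s"
  obtains a where "in_support a" "AE s in M. a \<le> s"
proof -
  define T where "T = {t. AE s in M. t \<le> s}"
  have "c \<in> T" using assms by (simp add: T_def)
  obtain n where n: "0 < cdf M (real n)"
    using order_tendstoD(1)[OF cdf_lim_infty_prob, of 0] by (auto simp: eventually_sequentially)
  have "t \<le> real n" if "t \<in> T" for t
  proof -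
    have "AE s in M. t \<le> s" "0 < prob {..real n}"
      using n that by (simp_all add: T_def cdf_def)
    then obtain s where "s \<in> {..real n}" "t \<le> s" by (rule AE_meets)
    then show ?thesis by simp
  qed
  then have bdd: "bdd_above T" by (auto simp: bdd_above_def)
  define a where "a = Sup T"
  have "AE s in M. a - 1 / real (Suc n) \<le> s" for n
  proof -
    have "a - 1 / real (Suc n) < Sup T" by (simp add: a_def)
    then obtain t where "t \<in> T" "a - 1 / real (Suc n) < t"
      using less_cSup_iff[OF _ bdd] \<open>c \<in> T\<close> by blast
    then show ?thesis by (auto simp: T_def)
  qed
  then have "AE s in M. \<forall>n. a - 1 / real (Suc n) \<le> s" by (simp add: AE_all_countable)
  then have ge: "AE s in M. a \<le> s"
  proof eventually_elim
    case (elim s)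
    show ?case
    proof (rule ccontr)
      assume "\<not> a \<le> s"
      then obtain n where "inverse (real (Suc n)) < a - s"
        using reals_Archimedean[of "a - s"] by auto
      with elim[rule_format, of n] show False by (simp add: inverse_eq_divide)
    qed
  qed
  have "in_support a"
    unfolding in_support_def
  proof (intro allI impI)
    fix \<delta> :: real assume "0 < \<delta>"
    show "0 < prob {a - \<delta><..<a + \<delta>}"
    proof (rule ccontr)
      assume "\<not> 0 < prob {a - \<delta><..<a + \<delta>}"
      then have "AE s in M. s \<notin> {a - \<delta><..<a + \<delta>}"
        by (subst prob_eq_0[symmetric]) (auto simp: not_less measure_le_0_iff)
      then have "a + \<delta> \<in> T"
        using ge \<open>0 < \<delta>\<close> by (auto simp: T_def elim: eventually_elim2)
      then have "a + \<delta> \<le> a" unfolding a_def by (intro cSup_upper bdd)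
      with \<open>0 < \<delta>\<close> show False by simp
    qed
  qed
  with ge that show ?thesis by blast
qed

lemma balanced_at_measurable: "{x. balanced_at x} \<in> sets borel"
proof -
  have "(\<lambda>z. prob {y. \<bar>y - snd z\<bar> < \<bar>fst z - snd z\<bar>}) \<in> borel_measurable (borel \<Otimes>\<^sub>M borel)"
    "(\<lambda>z. prob {y. \<bar>y - snd z\<bar> \<le> \<bar>fst z - snd z\<bar>}) \<in> borel_measurable (borel \<Otimes>\<^sub>M borel)"
    by (rule prob_section_measurable, measurable)+
  then have [measurable]: "(\<lambda>(x, s). nearer s x + as_near s x) \<in> borel_measurable (borel \<Otimes>\<^sub>M borel)"
    by (simp add: nearer_def as_near_def case_prod_beta)
  have "(\<lambda>x. \<integral>s. nearer s x + as_near s x \<partial>M) \<in> borel_measurable borel" by measurable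
  then show ?thesis unfolding balanced_at_def by measurable
qed

abbreviation reflected :: "real measure" where
  "reflected \<equiv> distr M borel uminus"

lemma real_distribution_reflected: "real_distribution reflected"
  by (rule real_distribution_distr) simp

interpretation reflected: real_distribution reflected
  by (rule real_distribution_reflected)

lemma prob_reflected:
  assumes "A \<in> sets borel"
  shows "measure reflected A = prob (uminus ` A)"
proof -
  have "uminus -` A = uminus ` A" by (force simp: image_iff)
  then show ?thesis using assms by (subst measure_distr) auto
qed

lemma AE_reflected:
  assumes "{x. P x} \<in> sets borel"
  shows "(AE x in reflected. P x) \<longleftrightarrow> (AE x in M. P (- x))"
  using assms by (subst AE_distr_iff) auto

lemma in_support_reflected: "reflected.in_support x \<longleftrightarrow> in_support (- x)"
  unfolding in_support_def reflected.in_support_def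
  by (simp add: prob_reflected image_uminus_greaterThanLessThan add.commute minus_diff_commute)

lemma balanced_at_reflected: "reflected.balanced_at x \<longleftrightarrow> balanced_at (- x)"
proof -
  have "reflected.nearer (- s) x = nearer s (- x)" for s
  proof -
    have "uminus -` {y. \<bar>y + s\<bar> < \<bar>x + s\<bar>} = {y. \<bar>y - s\<bar> < \<bar>- x - s\<bar>}" by auto
    then show ?thesis unfolding reflected.nearer_def nearer_def by (subst measure_distr) simp_all
  qed
  moreover have "reflected.as_near (- s) x = as_near s (- x)" for s
  proof -
    have "uminus -` {y. \<bar>y + s\<bar> \<le> \<bar>x + s\<bar>} = {y. \<bar>y - s\<bar> \<le> \<bar>- x - s\<bar>}" by auto
    then show ?thesis unfolding reflected.as_near_def as_near_def by (subst measure_distr) simp_all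
  qed
  ultimately show ?thesis
    unfolding balanced_at_def reflected.balanced_at_def by (subst integral_distr) simp_all
qed

end

text \<open>
  The two endpoint inequalities, with \<open>p\<close>, \<open>q\<close>, \<open>r\<close> the masses to the left of, to the right of and
  at the midpoint. After subtracting the total mass, the first forces \<open>q \<le> p\<close> and the second
  \<open>p \<le> q\<close>, unless the term of the midpoint is negative; mass at the midpoint makes the two
  inequalities incompatible in every case. So \<open>p = q\<close>, and then the squares have to vanish.
\<close>

lemma endpoint_masses_half:
  fixes p q r \<alpha> \<beta> u v :: real
  assumes total: "p + q + r = 1" and pu: "p = \<alpha> + u" and qv: "q = \<beta> + v"
    and nonneg: "0 \<le> \<alpha>" "0 \<le> \<beta>" "0 \<le> u" "0 \<le> v" "0 \<le> r" and pos: "0 < p" "0 < q"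
    and left: "q * (2 - \<alpha>) + p * \<alpha> + r * (if \<alpha> = 0 then 2 - 2 * \<beta> else 2 - \<alpha> - \<beta>) + u\<^sup>2 \<le> 1"
    and right: "p * (2 - \<beta>) + q * \<beta> + r * (if \<beta> = 0 then 2 - 2 * \<alpha> else 2 - \<beta> - \<alpha>) + v\<^sup>2 \<le> 1"
  shows "\<alpha> = 1/2" "\<beta> = 1/2"
proof -
  have lt: "\<alpha> < 1" "\<beta> < 1" using assms by linarith+
  have left': "(q - p) * (1 - \<alpha>) + r * (if \<alpha> = 0 then 1 - 2 * \<beta> else 1 - \<alpha> - \<beta>) + u\<^sup>2 \<le> 0"
    using left total by (auto simp: algebra_simps split: if_splits)
  have right': "(p - q) * (1 - \<beta>) + r * (if \<beta> = 0 then 1 - 2 * \<alpha> else 1 - \<beta> - \<alpha>) + v\<^sup>2 \<le> 0"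
    using right total by (auto simp: algebra_simps split: if_splits)
  have "r = 0"
  proof (rule ccontr)
    assume "r \<noteq> 0"
    then have r: "0 < r" using nonneg by simp
    have lt1: "\<alpha> + \<beta> < 1" using assms r by linarith
    have sq: "0 \<le> u\<^sup>2" "0 \<le> v\<^sup>2" by simp_all
    have neg: "x < 0" if "x * d + r * e + w \<le> 0" "0 < d" "0 < e" "0 \<le> w" for x d e w :: real
    proof (rule ccontr)
      assume "\<not> x < 0"
      then have "0 \<le> x * d" using that by simp
      moreover have "0 < r * e" using r that by simp
      ultimately show False using that by linarith
    qed
    consider "\<alpha> \<noteq> 0" "\<beta> \<noteq> 0" | "\<alpha> = 0" "\<beta> = 0" | "\<alpha> = 0" "\<beta> \<noteq> 0" | "\<alpha> \<noteq> 0" "\<beta> = 0" by blast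
    then show False
    proof cases
      case 1
      then have "q - p < 0" "p - q < 0"
        using neg[of "q - p" "1 - \<alpha>" "1 - \<alpha> - \<beta>" "u\<^sup>2"] neg[of "p - q" "1 - \<beta>" "1 - \<beta> - \<alpha>" "v\<^sup>2"] left' right' lt lt1
        by simp_all
      then show False by simp
    next
      case 2
      then have "q - p < 0" "p - q < 0"
        using neg[of "q - p" 1 1 "u\<^sup>2"] neg[of "p - q" 1 1 "v\<^sup>2"] left' right' by simp_all
      then show False by simp
    next
      case 3
      then have "(p - q + r) * (1 - \<beta>) \<le> 0"
        using right' by (simp add: algebra_simps) (use sq in linarith)
      then have "p - q + r \<le> 0" using lt by (simp add: mult_le_0_iff)
      moreover have "(q - p) + r * (1 - 2 * \<beta>) \<le> 0" using left' 3 sq by (simp, linarith)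
      moreover have "0 < r * (1 - \<beta>)" using r lt by simp
      ultimately show False by (simp add: algebra_simps)
    next
      case 4
      then have "(q - p + r) * (1 - \<alpha>) \<le> 0"
        using left' by (simp add: algebra_simps) (use sq in linarith)
      then have "q - p + r \<le> 0" using lt by (simp add: mult_le_0_iff)
      moreover have "(p - q) + r * (1 - 2 * \<alpha>) \<le> 0" using right' 4 sq by (simp, linarith)
      moreover have "0 < r * (1 - \<alpha>)" using r lt by simp
      ultimately show False by (simp add: algebra_simps)
    qed
  qed
  have "(q - p) * (1 - \<alpha>) + u\<^sup>2 \<le> 0" "(p - q) * (1 - \<beta>) + v\<^sup>2 \<le> 0"
    using left' right' \<open>r = 0\<close> by simp_all
  moreover from this have "(q - p) * (1 - \<alpha>) \<le> 0" "(p - q) * (1 - \<beta>) \<le> 0"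
    by (smt (verit) zero_le_power2)+
  then have "p = q" using lt by (simp add: mult_le_0_iff)
  ultimately have "u = 0" "v = 0" by simp_all
  then show "\<alpha> = 1/2" "\<beta> = 1/2" using \<open>p = q\<close> \<open>r = 0\<close> assms by linarith+
qed

context real_distribution begin

interpretation reflected: real_distribution reflected
  by (rule real_distribution_reflected)

lemma balanced_imp_one_or_two_atoms:
  assumes bal: "AE x in M. balanced_at x" and bounded: "AE x in M. x \<in> {c..d}"
  shows "(\<exists>a. prob {a} = 1) \<or> (\<exists>a b. a \<noteq> b \<and> prob {a} = 1/2 \<and> prob {b} = 1/2)"
proof -
  have "AE x in M. c \<le> x" using bounded by auto
  then obtain a where a: "in_support a" "AE x in M. a \<le> x" by (rule least_support_point)
  have "AE x in reflected. - d \<le> x"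
    using bounded by (subst AE_reflected) auto
  then obtain b' where b': "reflected.in_support b'" "AE x in reflected. b' \<le> x"
    by (rule reflected.least_support_point)
  define b where "b = - b'"
  have b: "in_support b" "AE x in M. x \<le> b"
    using b' by (auto simp: b_def in_support_reflected AE_reflected elim: eventually_mono)
  have hull: "AE x in M. x \<in> {a..b}" using a(2) b(2) by eventually_elim simp
  have "\<exists>x. x \<in> {a..b}" using AE_meets[OF hull, of UNIV] prob_space by auto
  then have "a \<le> b" by auto
  then consider "a = b" | "a < b" by linarith
  then show ?thesis
  proof cases
    case 1
    then have "prob {a} = 1" using hull by (subst prob_eq_1) (auto elim: eventually_mono)
    then show ?thesis by blast
  next
    case 2
    define m where "m = (a + b) / 2"
    have am: "a < m" "m < b" using 2 by (auto simp: m_def)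
    have hull': "AE x in reflected. x \<in> {- b..- a}"
      using hull by (subst AE_reflected) (auto elim: eventually_mono)
    have bal': "AE x in reflected. reflected.balanced_at x"
      using bal by (subst AE_reflected) (simp_all add: reflected.balanced_at_measurable, simp add: balanced_at_reflected)
    have supp': "reflected.in_support (- b)" using b(1) by (simp add: in_support_reflected)
    have "(- b + - a) / 2 = - m" by (simp add: m_def field_simps)
    then have right: "prob {a..<m} * (2 - prob {b}) + prob {m<..b} * prob {b}
      + prob {m} * (if prob {b} = 0 then 2 - 2 * prob {a} else 2 - prob {b} - prob {a})
      + (prob {m<..<b})\<^sup>2 \<le> 1"
      using reflected.endpoint_inequality[OF bal' supp' hull'] 2
      by (simp add: prob_reflected cong: if_cong)
    have left: "prob {m<..b} * (2 - prob {a}) + prob {a..<m} * prob {a}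
      + prob {m} * (if prob {a} = 0 then 2 - 2 * prob {b} else 2 - prob {a} - prob {b})
      + (prob {a<..<m})\<^sup>2 \<le> 1"
      using endpoint_inequality[OF bal a(1) hull 2] by (simp add: m_def)
    have "prob {a..b} = 1" using hull by (subst prob_eq_1) auto
    moreover have "{a..b} = {a..<m} \<union> ({m} \<union> {m<..b})" using am by auto
    then have "prob {a..b} = prob {a..<m} + prob ({m} \<union> {m<..b})"
      by (simp only:) (rule finite_measure_Union, auto)
    moreover have "prob ({m} \<union> {m<..b}) = prob {m} + prob {m<..b}"
      by (rule finite_measure_Union) auto
    ultimately have total: "prob {a..<m} + prob {m<..b} + prob {m} = 1" by simp
    have "{a..<m} = {a} \<union> {a<..<m}" using am by auto
    then have pu: "prob {a..<m} = prob {a} + prob {a<..<m}"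
      by (simp add: finite_measure_Union del: insert_is_Un Un_insert_left)
    have "{m<..b} = {b} \<union> {m<..<b}" using am by auto
    then have qv: "prob {m<..b} = prob {b} + prob {m<..<b}"
      by (simp add: finite_measure_Union del: insert_is_Un Un_insert_left)
    have "0 < prob {a - 1<..<m}" using a(1) am by (intro in_support_interval) auto
    also have "\<dots> = prob {a..<m}"
      using hull by (intro finite_measure_eq_AE) (auto elim: eventually_mono)
    finally have p: "0 < prob {a..<m}" .
    have "0 < prob {m<..<b + 1}" using b(1) am by (intro in_support_interval) auto
    also have "\<dots> = prob {m<..b}"
      using hull by (intro finite_measure_eq_AE) (auto elim: eventually_mono)
    finally have q: "0 < prob {m<..b}" .
    have "prob {a} = 1/2" "prob {b} = 1/2"
      using endpoint_masses_half[OF total pu qv _ _ _ _ _ p q left right] by simp_all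
    with 2 have "a \<noteq> b \<and> prob {a} = 1/2 \<and> prob {b} = 1/2" by simp
    then show ?thesis by blast
  qed
qed

end

section \<open>Invariant distributions on the unit interval\<close>

lemma (in real_distribution) nn_integral_farther_weight:
  "(\<integral>\<^sup>+s. \<integral>\<^sup>+y. farther_weight (dist s x) (dist s y) \<partial>M \<partial>M)
    = ennreal (\<integral>s. nearer s x + as_near s x \<partial>M)"
proof -
  have "(\<integral>\<^sup>+y. farther_weight (dist s x) (dist s y) \<partial>M) = ennreal (nearer s x + as_near s x)" for s
  proof -
    have "(\<integral>\<^sup>+y. farther_weight (dist s x) (dist s y) \<partial>M)
        = (\<integral>\<^sup>+y. of_bool (\<bar>y - s\<bar> < \<bar>x - s\<bar>) \<partial>M) + (\<integral>\<^sup>+y. of_bool (\<bar>y - s\<bar> \<le> \<bar>x - s\<bar>) \<partial>M)"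
      unfolding farther_weight_def dist_real_def
      by (subst nn_integral_add) (auto simp: abs_minus_commute)
    also have "\<dots> = emeasure M {y. \<bar>y - s\<bar> < \<bar>x - s\<bar>} + emeasure M {y. \<bar>y - s\<bar> \<le> \<bar>x - s\<bar>}"
      using emeasure_Collect_eq_nn_integral[of M "\<lambda>y. \<bar>y - s\<bar> < \<bar>x - s\<bar>"]
        emeasure_Collect_eq_nn_integral[of M "\<lambda>y. \<bar>y - s\<bar> \<le> \<bar>x - s\<bar>"] by simp
    finally show ?thesis
      by (simp add: nearer_def as_near_def emeasure_eq_measure)
  qed
  moreover have "integrable M (\<lambda>s. nearer s x + as_near s x)"
    using nearer_integrable as_near_integrable by simp
  moreover have "0 \<le> nearer s x + as_near s x" for s
    by (simp add: nearer_def as_near_def)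
  ultimately show ?thesis
    by (simp add: nn_integral_eq_integral del: ennreal_plus)
qed

lemma (in real_distribution) farther_weight_section_measurable:
  "(\<lambda>s. \<integral>\<^sup>+y. farther_weight (dist s x) (dist s y) \<partial>M) \<in> borel_measurable borel"
  by measurable

theorem theorem4:
  fixes \<phi> :: "real measure"
  assumes "pi_invariant {0..1} 2 2 \<phi>"
  shows "(\<exists>s\<in>{0..1}. \<phi> = point_mass {0..1} s) \<or>
         (\<exists>s1\<in>{0..1}. \<exists>s2\<in>{0..1}. s1 \<noteq> s2 \<and> \<phi> = two_point_mass {0..1} s1 s2)"
proof -
  let ?S = "{0..1::real}"
  have sets: "sets \<phi> = sets (restrict_space borel ?S)" and pr: "prob_space \<phi>"
    and inv: "pi_map 2 2 \<phi> = \<phi>"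
    using assms unfolding pi_invariant_def borel_probs_def by (auto simp: space_prob_algebra)
  have space: "space \<phi> = ?S"
    using sets_eq_imp_space_eq[OF sets] by (simp add: space_restrict_space)
  have id: "(\<lambda>x. x) \<in> borel_measurable \<phi>"
    using measurable_restrict_space1[OF measurable_ident, of borel ?S]
    by (simp add: id_def cong: measurable_cong_sets[OF sets refl])
  interpret farther_chain \<phi>
    by (intro farther_chain.intro farther_chain_axioms.intro pr id)
  have "stationary 2 2 \<phi> \<phi>"
    using theI'[OF stationary_unique] inv by (simp add: pi_map_def)
  then have out: "AE x in \<phi>. next_density \<phi> x = 1" by (rule self_stationary_imp_unit_density)
  \<comment> \<open>The same distribution on the whole line, where it can be reflected.\<close>
  define M where "M = distr \<phi> borel (\<lambda>x. x)"
  interpret M: real_distribution M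
    unfolding M_def using id by (rule real_distribution_distr)
  have M_eq: "emeasure M A = emeasure \<phi> A" if "A \<in> sets \<phi>" for A
  proof -
    have "A \<in> sets borel" "A \<subseteq> ?S" using that by (auto simp: sets sets_restrict_space)
    then show ?thesis
      unfolding M_def using id by (subst emeasure_distr) (auto simp: space Int_absorb2)
  qed
  have AE_M: "(AE x in M. P x) \<longleftrightarrow> (AE x in \<phi>. P x)" if "{x. P x} \<in> sets borel" for P
    unfolding M_def using id that by (subst AE_distr_iff) auto
  have transfer: "(\<integral>\<^sup>+s. g s \<partial>\<phi>) = (\<integral>\<^sup>+s. g s \<partial>M)" if "g \<in> borel_measurable borel" for g
    unfolding M_def using that id by (subst nn_integral_distr) auto
  have "next_density \<phi> x = ennreal (\<integral>s. M.nearer s x + M.as_near s x \<partial>M)" for x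
  proof -
    have "(\<integral>\<^sup>+y. farther_weight (dist s x) (dist s y) \<partial>\<phi>)
        = (\<integral>\<^sup>+y. farther_weight (dist s x) (dist s y) \<partial>M)" for s
      by (rule transfer) measurable
    then show ?thesis
      using transfer[OF M.farther_weight_section_measurable]
      by (simp add: next_density_def jump_density_def M.nn_integral_farther_weight)
  qed
  with out have "AE x in \<phi>. M.balanced_at x"
    by (simp add: M.balanced_at_def)
  then have bal: "AE x in M. M.balanced_at x"
    by (subst AE_M) (rule M.balanced_at_measurable)
  have "AE x in \<phi>. x \<in> ?S" by (rule AE_I2) (simp add: space)
  then have bounded: "AE x in M. x \<in> ?S"
    by (subst AE_M) simp_all
  have inS: "a \<in> ?S" if "0 < M.prob {a}" for a
    using M.AE_meets[OF bounded that] by blast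
  have conc: "M.prob A = M.prob (A \<inter> F)" if "M.prob F = 1" "F \<in> sets borel" "A \<in> sets borel" for A F
  proof -
    have "AE x in M. x \<in> F" using that M.prob_eq_1[of F] by simp
    then show ?thesis using that by (intro M.finite_measure_eq_AE) auto
  qed
  have borel: "A \<in> sets \<phi> \<Longrightarrow> A \<in> sets borel" for A
    by (auto simp: sets sets_restrict_space)
  from M.balanced_imp_one_or_two_atoms[OF bal bounded] show ?thesis
  proof (elim disjE exE conjE)
    fix a assume a: "M.prob {a} = 1"
    then have "a \<in> ?S" using inS by simp
    moreover have "\<phi> = point_mass ?S a"
    proof (rule measure_eqI)
      fix A assume A: "A \<in> sets \<phi>"
      have "emeasure \<phi> A = ennreal (M.prob (A \<inter> {a}))"
        using conc[OF a _ borel[OF A]] M_eq[OF A] by (simp add: M.emeasure_eq_measure)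
      also have "\<dots> = indicator A a" using a by (cases "a \<in> A") auto
      finally show "emeasure \<phi> A = emeasure (point_mass ?S a) A"
        using A by (simp add: point_mass_def sets)
    qed (simp add: point_mass_def sets)
    ultimately show ?thesis by blast
  next
    fix a b assume ab: "a \<noteq> b" "M.prob {a} = 1/2" "M.prob {b} = 1/2"
    then have "a \<in> ?S" "b \<in> ?S" using inS by simp_all
    moreover have "\<phi> = two_point_mass ?S a b"
    proof -
      have F: "M.prob {a, b} = 1"
        using ab M.finite_measure_Union[of "{a}" "{b}"] by (simp add: insert_commute)
      have val: "emeasure \<phi> A = 1 / 2 * (emeasure (point_mass ?S a) A + emeasure (point_mass ?S b) A)"
        if A: "A \<in> sets \<phi>" for A
      proof -
        have "emeasure \<phi> A = ennreal (M.prob (A \<inter> {a, b}))"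
          using conc[OF F _ borel[OF A]] M_eq[OF A] by (simp add: M.emeasure_eq_measure)
        also have "M.prob (A \<inter> {a, b}) = 1/2 * (indicator A a + indicator A b)"
          by (cases "a \<in> A"; cases "b \<in> A") (simp_all only: Int_insert_right Int_empty_right
              if_True if_False indicator_simps F ab measure_empty, simp_all)
        also have "ennreal \<dots> = ennreal (1/2) * ennreal (indicator A a + indicator A b)"
          by (rule ennreal_mult) (simp_all add: add_nonneg_nonneg)
        also have "ennreal (1/2) = 1/2"
          by (simp add: divide_ennreal_def)
        also have "ennreal (indicator A a + indicator A b) = indicator A a + indicator A b"
          by (simp add: ennreal_indicator)
        finally show ?thesis using A by (simp add: point_mass_def sets)
      qed
      have "\<phi> = measure_of (space \<phi>) (sets \<phi>) (emeasure \<phi>)"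
        by (rule measure_of_of_measure[symmetric])
      also have "\<dots> = measure_of (space \<phi>) (sets \<phi>)
          (\<lambda>A. 1 / 2 * (emeasure (point_mass ?S a) A + emeasure (point_mass ?S b) A))"
        by (rule measure_of_eq[OF sets.space_closed], rule val) (simp only: sets.sigma_sets_eq)
      also have "\<dots> = two_point_mass ?S a b"
        by (simp only: two_point_mass_def space sets)
      finally show ?thesis .
    qed
    ultimately show ?thesis using ab(1) by blast
  qed
qed

end
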